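(* Let $0<\alpha<2$ and $p\in[1,\infty]$. Let $(d_n)$ be a monotone sequence of positive numbers and $(\vartheta_n)$ a decreasing sequence of positive numbers with $\vartheta_n\to0$, such that $d_n\approx d_{2n}$ and $\vartheta_n\approx\vartheta_{2n}$. Assume $$\sum_{n=1}^\infty\frac{d_n^{-\alpha}}{n}<\infty,$$ and let $A_n\subseteq[0,1]$ be pairwise disjoint measurable sets with Lebesgue measure $|A_n|=c\,d_n^{-\alpha}n^{-1}$, where $c>0$ is a constant (small enough that such sets exist). Assume moreover that $$\sup_{n\ge k}\left(\frac nk\right)^a\frac{\vartheta_n}{\vartheta_k}<\infty\quad\text{for some }a>[1/\alpha-1/p]_+$$ and $$\sup_{n\ge k}\left(\frac nk\right)^b\frac{\vartheta_n|A_n|^{-1/\alpha}}{\vartheta_k|A_k|^{-1/\alpha}}<\infty\quad\text{for some }b>0.$$ Then, for the operator $u:\ell_p\to L_\alpha[0,1]$ defined by $$u\big((z_n)\big)=\sum_{n=1}^\infty\vartheta_nz_n\frac{\mathbf{1}_{A_n}}{|A_n|^{1/\alpha}},$$ the entropy gap $\mathcal{G}_n(u)$ is of order at most $d_n$, i.e. $$\mathbb{Q}\left(\limsup_{n\to\infty}\frac{\mathcal{G}_n(u)}{d_n}<\infty\right)=1.$$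
   Context: Suprema are over all $1\le k\le n$. $f\approx g$ means $\limsup f/g<\infty$ and $\limsup g/f<\infty$; $[x]_+=\max(x,0)$; $1/\infty=0$. Entropy gap: let $(S,\sigma)$ be a finite measure space (here $S=[0,1]$ with Lebesgue measure, $E=\ell_p$) and $u:E\to L_\alpha(S,\sigma)$ a decomposed operator, i.e. $(uz)(s)=\langle z,\varphi(s)\rangle$ for a measurable $\varphi:S\to E'$ with $\int_S\|\varphi\|_{E'}^\alpha d\sigma<\infty$. On a probability space $(\Delta,\mathbb{Q})$ let $(V_j)$ be i.i.d. $S$-valued with law $\sigma/\sigma(S)$ and, independently, $(\zeta_j)$ i.i.d. standard exponential; $\Gamma_j:=\zeta_1+\dots+\zeta_j$. With $c_\alpha:=\sqrt2\left(\int_0^\infty x^{-\alpha}\sin x\,dx\right)^{-1/\alpha}(\mathbf{E}|\xi|^\alpha)^{-1/\alpha}$, $\xi$ standard normal, the random operator $v:E\to\ell_2$ associated with $u$ is $v(z):=c_\alpha\sigma(S)^{1/\alpha}\left((uz)(V_j)\Gamma_j^{-1/\alpha}\right)_{j\ge1}$. The $n$-th entropy gap is the random variable $$\mathcal{G}_n(u):=\frac{e_n(v)}{n^{-1/\alpha+1/2}e_n(u)}.$$ Dyadic entropy numbers of an operator $w:E\to F$ (with $F$ quasi-normed): $e_n(w):=\inf\{\varepsilon>0\mid\exists y_1,\dots,y_{2^{n-1}}\in F\ \forall z\in E,\|z\|\le1\ \exists i\le2^{n-1}:\ \|w(z)-y_i\|\le\varepsilon\}$. *)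

theory Defs
  imports "HOL-Probability.Probability"
begin

text \<open>
  Elements of \<open>L\<^sub>r(M)\<close> are represented by measurable functions, without passing to a.e. classes;
  (quasi-)norms are extended-valued, being \<open>\<infinity>\<close> outside the space.
\<close>

definition Lr_norm :: "real \<Rightarrow> 'a measure \<Rightarrow> ('a \<Rightarrow> real) \<Rightarrow> ereal" where
  "Lr_norm r M f =
     (if integrable M (\<lambda>x. \<bar>f x\<bar> powr r) then ereal ((\<integral>x. \<bar>f x\<bar> powr r \<partial>M) powr (1 / r)) else \<infinity>)"

definition Lr_space :: "real \<Rightarrow> 'a measure \<Rightarrow> ('a \<Rightarrow> real) set" where
  "Lr_space r M = {f \<in> borel_measurable M. Lr_norm r M f < \<infinity>}"

text \<open>Sequences are indexed by \<open>n \<ge> 1\<close>; the value of the representing function at \<open>0\<close> is ignored.\<close>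

definition lp_norm :: "ereal \<Rightarrow> (nat \<Rightarrow> real) \<Rightarrow> ereal" where
  "lp_norm p z = (if p = \<infinity> then (SUP n\<in>{1..}. ereal \<bar>z n\<bar>)
                  else Lr_norm (real_of_ereal p) (count_space {1..}) z)"

definition lp_space :: "ereal \<Rightarrow> (nat \<Rightarrow> real) set" where
  "lp_space p = {z. lp_norm p z < \<infinity>}"

text \<open>
  Dyadic entropy numbers of \<open>w : E \<rightarrow> F\<close>, where \<open>E\<close> and \<open>F\<close> are given by their carriers and
  (quasi-)norms \<open>NE\<close> and \<open>NF\<close>. The value is \<open>\<infinity>\<close> if there is no admissible \<open>\<epsilon>\<close>.
\<close>

definition entropy_number ::
  "'e set \<Rightarrow> ('e \<Rightarrow> ereal) \<Rightarrow> 'f set \<Rightarrow> ('f \<Rightarrow> ereal) \<Rightarrow> nat \<Rightarrow> ('e \<Rightarrow> 'f::minus) \<Rightarrow> ereal" where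
  "entropy_number E NE F NF n w =
     Inf {ereal \<epsilon> | \<epsilon>. 0 < \<epsilon> \<and>
       (\<exists>y :: nat \<Rightarrow> 'f. (\<forall>i\<in>{1..2 ^ (n - 1)}. y i \<in> F) \<and>
         (\<forall>z\<in>E. NE z \<le> 1 \<longrightarrow> (\<exists>i\<in>{1..2 ^ (n - 1)}. NF (w z - y i) \<le> ereal \<epsilon>)))}"

text \<open>
  The first integral is only conditionally convergent for \<open>\<alpha> \<le> 1\<close>; \<open>integral\<close> is the
  Henstock-Kurzweil integral, which agrees with the improper integral there.
\<close>

definition c_const :: "real \<Rightarrow> real" where
  "c_const \<alpha> = sqrt 2
     * (integral {0..} (\<lambda>x::real. x powr (- \<alpha>) * sin x)) powr (- 1 / \<alpha>)
     * (\<integral>x. \<bar>x\<bar> powr \<alpha> \<partial>std_normal_distribution) powr (- 1 / \<alpha>)"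

locale random_series = prob_space Q
  for Q :: "'d measure" and \<sigma> :: "'s measure"
    and V :: "nat \<Rightarrow> 'd \<Rightarrow> 's" and \<zeta> :: "nat \<Rightarrow> 'd \<Rightarrow> real" +
  assumes V_measurable: "\<And>j. j \<ge> 1 \<Longrightarrow> V j \<in> measurable Q \<sigma>"
    and V_law: "\<And>j. j \<ge> 1 \<Longrightarrow> distr Q \<sigma> (V j) = uniform_measure \<sigma> (space \<sigma>)"
    and V_indep: "indep_vars (\<lambda>_. \<sigma>) V {1..}"
    and \<zeta>_law: "\<And>j. j \<ge> 1 \<Longrightarrow> distributed Q lborel (\<zeta> j) (exponential_density 1)"
    and \<zeta>_indep: "indep_vars (\<lambda>_. borel) \<zeta> {1..}"
    and V_\<zeta>_indep: "indep_set
          (sets (vimage_algebra (space Q) (\<lambda>\<omega>. \<lambda>j\<in>{1..}. V j \<omega>) (Pi\<^sub>M {1..} (\<lambda>_. \<sigma>))))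
          (sets (vimage_algebra (space Q) (\<lambda>\<omega>. \<lambda>j\<in>{1..}. \<zeta> j \<omega>) (Pi\<^sub>M {1..} (\<lambda>_. borel))))"

definition arrival :: "(nat \<Rightarrow> 'd \<Rightarrow> real) \<Rightarrow> nat \<Rightarrow> 'd \<Rightarrow> real" where
  "arrival \<zeta> j \<omega> = (\<Sum>i = 1..j. \<zeta> i \<omega>)"

text \<open>
  A decomposed operator \<open>u\<close> is given together with its pointwise values
  \<open>u z s = \<langle>z, \<phi> s\<rangle>\<close>, so that evaluation at \<open>V j \<omega>\<close> makes sense.
\<close>

definition random_operator ::
  "real \<Rightarrow> 's measure \<Rightarrow> (nat \<Rightarrow> 'd \<Rightarrow> 's) \<Rightarrow> (nat \<Rightarrow> 'd \<Rightarrow> real) \<Rightarrow> ('e \<Rightarrow> 's \<Rightarrow> real)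
     \<Rightarrow> 'd \<Rightarrow> 'e \<Rightarrow> nat \<Rightarrow> real" where
  "random_operator \<alpha> \<sigma> V \<zeta> u \<omega> z =
     (\<lambda>j. c_const \<alpha> * measure \<sigma> (space \<sigma>) powr (1 / \<alpha>)
            * (u z (V j \<omega>) * arrival \<zeta> j \<omega> powr (- 1 / \<alpha>)))"

definition entropy_gap ::
  "'e set \<Rightarrow> ('e \<Rightarrow> ereal) \<Rightarrow> real \<Rightarrow> 's measure \<Rightarrow> (nat \<Rightarrow> 'd \<Rightarrow> 's) \<Rightarrow> (nat \<Rightarrow> 'd \<Rightarrow> real)
     \<Rightarrow> ('e \<Rightarrow> 's \<Rightarrow> real) \<Rightarrow> nat \<Rightarrow> 'd \<Rightarrow> ereal" where
  "entropy_gap E NE \<alpha> \<sigma> V \<zeta> u n \<omega> =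
     entropy_number E NE (lp_space 2) (lp_norm 2) n (random_operator \<alpha> \<sigma> V \<zeta> u \<omega>)
     / (ereal (real n powr (- 1 / \<alpha> + 1 / 2))
        * entropy_number E NE (Lr_space \<alpha> \<sigma>) (Lr_norm \<alpha> \<sigma>) n u)"

definition same_order :: "(nat \<Rightarrow> real) \<Rightarrow> (nat \<Rightarrow> real) \<Rightarrow> bool" where
  "same_order f g \<longleftrightarrow> limsup (\<lambda>n. ereal (f n / g n)) < \<infinity> \<and> limsup (\<lambda>n. ereal (g n / f n)) < \<infinity>"

end

theory Submission
  imports Defs
begin

text \<open>
  Write \<open>q = 1/p\<close> and \<open>\<mu>\<^sub>m = \<theta>\<^sub>m |A\<^sub>m|\<^sup>-\<^sup>1\<^sup>/\<^sup>\<alpha>\<close>. The normalised indicators of the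
  sets \<open>A\<^sub>m\<close> are disjointly supported, so \<open>u\<close> acts like the diagonal operator with entries
  \<open>\<theta>\<^sub>m\<close> from \<open>\<ell>\<^sub>p\<close> to \<open>\<ell>\<^sub>\<alpha>\<close>. A coordinate \<open>j\<close> of the random operator \<open>v\<close> sees only the entry
  \<open>z\<^sub>m\<close> with \<open>V\<^sub>j \<in> A\<^sub>m\<close>, so \<open>v\<close> acts like the diagonal operator from \<open>\<ell>\<^sub>p\<close> to \<open>\<ell>\<^sub>2\<close> whose \<open>m\<close>-th
  entry is, up to a constant, \<open>\<mu>\<^sub>m\<close> times the square root of the sum of \<open>\<Gamma>\<^sub>j\<^sup>-\<^sup>2\<^sup>/\<^sup>\<alpha>\<close>
  over those \<open>j\<close>. As \<open>\<mu>\<^sub>n\<close> is proportional to \<open>\<theta>\<^sub>n d\<^sub>n n\<^sup>1\<^sup>/\<^sup>\<alpha>\<close>, the theorem is the quotient of two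
  estimates: \<open>e\<^sub>n(u)\<close> is at least a constant times \<open>\<theta>\<^sub>n n\<^sup>1\<^sup>/\<^sup>\<alpha>\<^sup>-\<^sup>q\<close>, and almost surely \<open>e\<^sub>n(v)\<close> is at most a
  random constant times \<open>\<mu>\<^sub>n n\<^sup>-\<^sup>1\<^sup>/\<^sup>\<alpha>\<^sup>+\<^sup>1\<^sup>/\<^sup>2\<^sup>-\<^sup>q\<close>.

  The lower estimate (\<open>entropy_number_disjoint_support_ge\<close>) is a packing argument: among the
  \<open>4\<^sup>n\<close> flat vectors supported by subsets of \<open>{1..2n}\<close>, one of \<open>2\<^sup>n\<^sup>-\<^sup>1\<close> balls contains the images of
  so many that two of them differ in more than \<open>n/8\<close> coordinates.

  The upper estimate uses a single random fact, namely that almost surely \<open>\<Gamma>\<^sub>j \<ge> c j\<close> for all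
  \<open>j \<ge> 1\<close> with some random \<open>c > 0\<close> (\<open>AE_arrival_linear_growth\<close>). The rest holds path by path,
  however the points \<open>V\<^sub>j\<close> are distributed over the sets \<open>A\<^sub>m\<close>. Fix \<open>n\<close>, put
  \<open>\<tau> = \<mu>\<^sub>n n\<^sup>-\<^sup>1\<^sup>/\<^sup>\<alpha>\<close>, let \<open>\<rho>\<^sub>m\<close> be the diagonal entries of \<open>v\<close> divided by \<open>\<tau>\<close>, and let
  \<open>\<gamma> = 1 + \<alpha>/2\<close>, which lies strictly between \<open>\<alpha>\<close> and \<open>2\<close>. The size of \<open>\<rho>\<close> is measured by the
  sum of \<open>ln (1 + \<rho>\<^sub>m\<^sup>\<gamma>)\<close>. As \<open>\<gamma> < 2\<close>, the function \<open>ln (1 + r\<^sup>\<gamma>\<^sup>/\<^sup>2)\<close> is subadditive in \<open>r\<close>, so that the points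
  falling into one set can be separated again; what remains is a sum over \<open>j\<close> of
  \<open>ln (1 + K (n/j)\<^sup>\<gamma>\<^sup>/\<^sup>\<alpha>)\<close>, and this is of order \<open>n\<close> because \<open>\<gamma>/\<alpha> > 1\<close>. The growth conditions enter
  through \<open>\<mu>\<^sub>m \<le> M \<mu>\<^sub>n\<close> for \<open>m \<ge> n\<close> and \<open>\<mu>\<^sub>m \<le> M (n/m)\<^sup>B \<mu>\<^sub>n\<close> for \<open>m \<le> n\<close>; the latter costs
  another sum of the same kind (\<open>sum_ln_1p_diagonal_le\<close>).

  A diagonal operator with \<open>\<Sum> ln (1 + \<rho>\<^sub>m\<^sup>\<gamma>) = O(n)\<close> maps the unit ball of \<open>\<ell>\<^sub>p\<close> into the union of
  \<open>exp (O(n))\<close> balls of radius \<open>O(n\<^sup>1\<^sup>/\<^sup>2\<^sup>-\<^sup>q)\<close> (\<open>diagonal_net\<close>): round the \<open>m\<close>-th coordinate towards zero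
  to a grid of width \<open>n\<^sup>-\<^sup>q s\<^sub>m\<close>, where \<open>s\<^sub>m\<close> is small for large \<open>\<rho>\<^sub>m\<close> and large for small \<open>\<rho>\<^sub>m\<close>, and
  count the resulting integer vectors with exponential weights.

  Since \<open>Q\<close> need not be complete, the almost sure statement yields probability one only
  together with measurability of the event; for this the entropy numbers of \<open>v\<close> are described by
  countably many conditions on its coordinates (\<open>entropy_number_less_iff\<close>).
\<close>

section \<open>Elementary inequalities\<close>

text \<open>Homogeneity reduces this to \<open>x + y = 1\<close>, where \<open>t \<le> t\<^sup>h\<close> for both summands.\<close>

lemma powr_add_subadditive:
  fixes x y h :: real
  assumes "0 \<le> x" "0 \<le> y" "0 < h" "h \<le> 1"
  shows "(x + y) powr h \<le> x powr h + y powr h"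
proof (cases "x + y = 0")
  case True
  then show ?thesis using assms by auto
next
  case False
  then have pos: "x + y > 0" using assms by linarith
  have le: "t \<le> t powr h" if "0 \<le> t" "t \<le> 1" for t :: real
    using that assms powr_mono'[of h 1 t] by simp
  have "1 = x / (x + y) + y / (x + y)"
    using pos by (simp add: add_divide_distrib[symmetric])
  also have "\<dots> \<le> (x / (x + y)) powr h + (y / (x + y)) powr h"
    using assms pos by (intro add_mono le) (auto simp: divide_simps)
  also have "\<dots> = (x powr h + y powr h) / (x + y) powr h"
    using assms pos by (simp add: powr_divide add_divide_distrib)
  finally show ?thesis
    using pos by (simp add: divide_simps)
qed

text \<open>Subadditivity of \<open>r \<mapsto> ln (1 + r\<^sup>h)\<close>, from that of \<open>r\<^sup>h\<close> and from \<open>1 + x + y \<le> (1 + x) (1 + y)\<close>. It undoes the merging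
  of several terms into one diagonal entry.\<close>

lemma ln_1p_powr_sum_le:
  fixes a :: "'i \<Rightarrow> real"
  assumes "finite I" "\<And>i. i \<in> I \<Longrightarrow> 0 \<le> a i" "0 < h" "h \<le> 1"
  shows "ln (1 + (\<Sum>i\<in>I. a i) powr h) \<le> (\<Sum>i\<in>I. ln (1 + a i powr h))"
  using assms(1,2)
proof (induction I rule: finite_induct)
  case empty
  then show ?case by simp
next
  case (insert j I)
  let ?s = "\<Sum>i\<in>I. a i"
  have s: "0 \<le> ?s" "0 \<le> a j" using insert by (auto intro: sum_nonneg)
  have "1 + (a j + ?s) powr h \<le> (1 + a j powr h) * (1 + ?s powr h)"
  proof -
    have "0 \<le> a j powr h * ?s powr h" by simp
    moreover have "(1 + a j powr h) * (1 + ?s powr h) = 1 + a j powr h + ?s powr h + a j powr h * ?s powr h"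
      by (simp add: algebra_simps)
    ultimately show ?thesis
      using powr_add_subadditive[OF s(2,1) assms(3,4)] by linarith
  qed
  then have "ln (1 + (a j + ?s) powr h) \<le> ln ((1 + a j powr h) * (1 + ?s powr h))"
    by (subst ln_le_cancel_iff) (auto intro!: mult_pos_pos add_pos_nonneg)
  also have "\<dots> = ln (1 + a j powr h) + ln (1 + ?s powr h)"
    by (subst ln_mult) (auto simp: add_pos_nonneg less_imp_neq[symmetric] intro!: add_pos_nonneg)
  finally show ?case using insert by (simp add: insert.hyps)
qed

lemma sum_inverse_sqrt_le: "(\<Sum>j=1..n. 1 / sqrt (real j)) \<le> 2 * sqrt (real n)"
proof (induction n)
  case (Suc n)
  have "1 / sqrt (real (Suc n)) \<le> 2 * (sqrt (real (Suc n)) - sqrt (real n))"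
  proof -
    have "(sqrt (real (Suc n)) - sqrt (real n)) * (sqrt (real (Suc n)) + sqrt (real n)) = 1"
      by (simp add: algebra_simps)
    then have "sqrt (real (Suc n)) - sqrt (real n) = 1 / (sqrt (real (Suc n)) + sqrt (real n))"
      by (simp add: field_simps add_pos_nonneg less_imp_neq[symmetric] add_nonneg_eq_0_iff)
    also have "\<dots> \<ge> 1 / (2 * sqrt (real (Suc n)))"
      by (intro divide_left_mono) (auto intro!: mult_pos_pos add_pos_nonneg)
    finally show ?thesis by simp
  qed
  then show ?case using Suc by simp
qed simp

lemma sum_tail_powr_le:
  assumes "1 < k" "1 \<le> n"
  shows "(\<Sum>j=Suc n..M. real j powr - k) \<le> real n powr (1 - k) / (k - 1)"
proof (cases "n \<le> M")
  case True
  have "(\<Sum>j=Suc n..M. real j powr - k) \<le> (real n powr (1 - k) - real M powr (1 - k)) / (k - 1)"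
    using True
  proof (induction M rule: dec_induct)
    case (step M)
    have M: "real M > 0" using step assms by auto
    have "\<exists>z. real M < z \<and> z < real (Suc M) \<and> 
       real (Suc M) powr (1 - k) - real M powr (1 - k) = (real (Suc M) - real M) * ((1 - k) * z powr (1 - k - 1))"
      by (rule MVT2) (use M in \<open>auto intro!: derivative_eq_intros\<close>)
    then obtain z where z: "real M < z" "z < real (Suc M)"
       "real M powr (1 - k) - real (Suc M) powr (1 - k) = (k - 1) * z powr - k"
      by (auto simp: algebra_simps)
    have "real (Suc M) powr - k \<le> z powr - k"
      using z M assms by (intro powr_mono2') auto
    also have "\<dots> = (real M powr (1 - k) - real (Suc M) powr (1 - k)) / (k - 1)"
      using z(3) assms by simp
    finally show ?case using step by (simp add: diff_divide_distrib)
  qed simp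
  also have "\<dots> \<le> real n powr (1 - k) / (k - 1)"
    using assms by (intro divide_right_mono) auto
  finally show ?thesis .
qed (use assms in auto)

text \<open>The bound is linear in \<open>n\<close>, uniformly in the number \<open>M\<close> of terms: up to \<open>j = n\<close> the terms grow only
  like \<open>ln (n/j)\<close>, beyond that they are dominated by the convergent tail of \<open>(n/j)\<^sup>k\<close>.\<close>

lemma sum_ln_1p_powr_le:
  assumes K: "0 < K" and k: "1 < k"
  obtains C where "0 < C"
    "\<And>n M. 1 \<le> n \<Longrightarrow> (\<Sum>j=1..M. ln (1 + K * (real n / real j) powr k)) \<le> C * real n"
proof
  define C where "C = ln (1 + K) + 4 * k + K / (k - 1)"
  show "0 < C" unfolding C_def using assms by (intro add_nonneg_pos add_nonneg_nonneg) auto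
  fix n M :: nat assume n: "1 \<le> n"
  let ?t = "\<lambda>j. ln (1 + K * (real n / real j) powr k)"
  have t0: "0 \<le> ?t j" for j using K by (auto intro!: ln_ge_zero)
  have "(\<Sum>j=1..M. ?t j) \<le> (\<Sum>j\<in>{1..n} \<union> {Suc n..M}. ?t j)"
    by (rule sum_mono2) (auto simp: t0)
  also have "\<dots> = (\<Sum>j=1..n. ?t j) + (\<Sum>j=Suc n..M. ?t j)"
    by (rule sum.union_disjoint) auto
  also have "(\<Sum>j=1..n. ?t j) \<le> (\<Sum>j=1..n. ln (1 + K) + 2 * k * (sqrt (real n) * (1 / sqrt (real j))))"
  proof (rule sum_mono)
    fix j assume j: "j \<in> {1..n}"
    define x where "x = real n / real j"
    have x: "1 \<le> x" using j by (auto simp: x_def)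
    have "1 + K * x powr k \<le> (1 + K) * x powr k"
      using ge_one_powr_ge_zero[OF x, of k] k by (simp add: algebra_simps)
    then have "ln (1 + K * x powr k) \<le> ln ((1 + K) * x powr k)"
      using K x by (subst ln_le_cancel_iff) (auto intro!: mult_pos_pos add_pos_nonneg)
    also have "\<dots> = ln (1 + K) + k * ln x"
      using K x by (simp add: ln_mult ln_powr)
    also have "ln x = 2 * ln (sqrt x)" using x by (simp add: ln_sqrt)
    also have "ln (sqrt x) \<le> sqrt x" using x ln_le_minus_one[of "sqrt x"] by simp
    finally show "?t j \<le> ln (1 + K) + 2 * k * (sqrt (real n) * (1 / sqrt (real j)))"
      using k by (simp add: x_def real_sqrt_divide mult_ac)
  qed
  also have "\<dots> = n * ln (1 + K) + 2 * k * (sqrt (real n) * (\<Sum>j=1..n. 1 / sqrt (real j)))"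
    by (simp add: sum.distrib sum_distrib_left)
  also have "\<dots> \<le> n * ln (1 + K) + 2 * k * (sqrt (real n) * (2 * sqrt (real n)))"
    using sum_inverse_sqrt_le[of n] k by (intro add_left_mono mult_left_mono) auto
  also have "\<dots> = n * (ln (1 + K) + 4 * k)" by (simp add: algebra_simps)
  also have "(\<Sum>j=Suc n..M. ?t j) \<le> (\<Sum>j=Suc n..M. K * real n powr k * real j powr - k)"
  proof (rule sum_mono)
    fix j assume j: "j \<in> {Suc n..M}"
    have "?t j \<le> K * (real n / real j) powr k"
      using K by (intro ln_add_one_self_le_self) auto
    also have "\<dots> = K * real n powr k * real j powr - k"
      using j n by (simp add: powr_divide powr_minus_divide)
    finally show "?t j \<le> K * real n powr k * real j powr - k" .
  qed
  also have "\<dots> = K * real n powr k * (\<Sum>j=Suc n..M. real j powr - k)"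
    by (simp add: sum_distrib_left)
  also have "\<dots> \<le> K * real n powr k * (real n powr (1 - k) / (k - 1))"
    using K by (intro mult_left_mono sum_tail_powr_le k n) auto
  also have "\<dots> = n * (K / (k - 1))"
    using n by (simp add: powr_add[symmetric])
  finally show "(\<Sum>j=1..M. ?t j) \<le> C * real n"
    by (simp add: C_def algebra_simps)
qed

lemma le_two_ln_1p:
  fixes y :: real
  assumes "0 \<le> y" "y \<le> 1"
  shows "y \<le> 2 * ln (1 + y)"
proof -
  have "ln (inverse (1 + y)) \<le> inverse (1 + y) - 1"
    using assms by (intro ln_le_minus_one) auto
  then have "1 - inverse (1 + y) \<le> ln (1 + y)"
    using assms by (simp add: ln_inverse)
  moreover have "y / 2 \<le> 1 - inverse (1 + y)"
    using assms mult_left_mono[of "1 + y" 2 y] by (simp add: field_simps)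
  ultimately show ?thesis by simp
qed

text \<open>A polynomial lower bound of arbitrary degree, obtained from \<open>exp s = (exp (s/L))\<^sup>L \<ge> (1 + s/L)\<^sup>L\<close>.\<close>

lemma exp_minus_one_ge_power:
  fixes s :: real
  assumes "0 \<le> s" "1 \<le> L"
  shows "(s / real L) ^ L \<le> exp s - 1"
proof -
  have aux: "1 + t ^ Suc l \<le> (1 + t) ^ Suc l" if "0 \<le> t" for t :: real and l
  proof (induction l)
    case (Suc l)
    have "1 + t ^ Suc (Suc l) \<le> (1 + t) * (1 + t ^ Suc l)"
      using that by (simp add: algebra_simps)
    also have "\<dots> \<le> (1 + t) * (1 + t) ^ Suc l"
      using that Suc by (intro mult_left_mono) auto
    finally show ?case by simp
  qed simp
  have "1 + (s / real L) ^ L \<le> (1 + s / real L) ^ L"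
    using aux[of "s / real L" "L - 1"] assms by simp
  also have "\<dots> \<le> exp (s / real L) ^ L"
    using assms exp_ge_add_one_self[of "s / real L"] by (intro power_mono) auto
  also have "\<dots> = exp s" using assms by (simp add: exp_of_nat_mult[symmetric])
  finally show ?thesis by simp
qed

lemma powr_comparable:
  fixes m n L e :: real
  assumes "0 < m" "m \<le> n" "n \<le> L * m"
  shows "m powr e \<le> L powr \<bar>e\<bar> * n powr e"
proof -
  have r: "1 \<le> n / m" "n / m \<le> L" using assms by (auto simp: field_simps)
  have "m powr e = (n / m) powr (- e) * n powr e"
    using assms by (simp add: powr_divide powr_minus_divide)
  also have "(n / m) powr (- e) \<le> (n / m) powr \<bar>e\<bar>" using r by (intro powr_mono) auto
  also have "\<dots> \<le> L powr \<bar>e\<bar>" using r by (intro powr_mono2) auto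
  finally show ?thesis by (simp add: mult_right_mono)
qed

lemma abs_diff_powr_le:
  fixes x y z r :: real
  assumes "0 < r"
  shows "\<bar>x - y\<bar> powr r \<le> 2 powr r * (\<bar>x - z\<bar> powr r + \<bar>y - z\<bar> powr r)"
proof -
  define m where "m = max \<bar>x - z\<bar> \<bar>y - z\<bar>"
  have "\<bar>x - z\<bar> \<le> m" "\<bar>y - z\<bar> \<le> m" by (auto simp: m_def)
  then have "\<bar>x - y\<bar> \<le> 2 * m" by linarith
  then have "\<bar>x - y\<bar> powr r \<le> (2 * m) powr r"
    using assms by (intro powr_mono2) auto
  also have "\<dots> = 2 powr r * m powr r" by (simp add: powr_mult m_def)
  also have "m powr r \<le> \<bar>x - z\<bar> powr r + \<bar>y - z\<bar> powr r" by (auto simp: m_def max_def)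
  finally show ?thesis by simp
qed

lemma ereal_ratio_le:
  assumes "x \<le> ereal X" "ereal Y \<le> y" "0 < Y" "0 < k" "0 < d" "0 \<le> X"
  shows "x / (ereal k * y) / ereal d \<le> ereal (X / (k * Y) / d)"
proof (cases y)
  case (real r)
  have r: "0 < r" "Y \<le> r" using assms real by auto
  have "x / (ereal k * y) = x / ereal (k * r)" using real by simp
  also have "\<dots> \<le> ereal X / ereal (k * r)"
    using assms(1,4) r by (intro ereal_divide_right_mono) auto
  also have "\<dots> = ereal (X / (k * r))" using assms r by simp
  also have "\<dots> \<le> ereal (X / (k * Y))"
    using assms r by (auto intro!: divide_left_mono mult_left_mono)
  finally have "x / (ereal k * y) / ereal d \<le> ereal (X / (k * Y)) / ereal d"
    using assms(5) by (intro ereal_divide_right_mono) auto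
  then show ?thesis using assms(5) by simp
qed (use assms in auto)

section \<open>Unit balls of sequence spaces\<close>

text \<open>Norm bounds are reduced to bounds on finite sums here, so that neither integrals nor summability
  appear in the arguments about sequences.\<close>

lemma Lr_norm_count_le_iff:
  fixes z :: "nat \<Rightarrow> real"
  assumes r: "0 < r" and t: "0 \<le> t"
  shows "Lr_norm r (count_space {1..}) z \<le> ereal t \<longleftrightarrow>
    (\<forall>F. finite F \<and> F \<subseteq> {1..} \<longrightarrow> (\<Sum>j\<in>F. \<bar>z j\<bar> powr r) \<le> t powr r)"
proof -
  let ?f = "\<lambda>j. \<bar>z j\<bar> powr r"
  have int_iff: "integrable (count_space {1..}) ?f \<longleftrightarrow> ?f summable_on {1..}"
    using summable_on_iff_abs_summable_on_real[of ?f "{1..}"]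
    by (simp add: Infinite_Set_Sum.abs_summable_on_def[symmetric] abs_summable_equivalent[symmetric])
  have int_eq: "(\<integral>x. ?f x \<partial>count_space {1..}) = infsum ?f {1..}" if "?f summable_on {1..}"
    using that infsetsum_infsum[of ?f "{1..}"]
    by (simp add: infsetsum_def abs_summable_equivalent[symmetric])
  have root_le: "x powr (1 / r) \<le> t \<longleftrightarrow> x \<le> t powr r" if "0 \<le> x" for x
  proof
    assume "x powr (1 / r) \<le> t"
    then have "(x powr (1 / r)) powr r \<le> t powr r" using r by (intro powr_mono2) auto
    then show "x \<le> t powr r" using that r by (simp add: powr_powr)
  next
    assume "x \<le> t powr r"
    then have "x powr (1 / r) \<le> (t powr r) powr (1 / r)" using r that by (intro powr_mono2) auto
    then show "x powr (1 / r) \<le> t" using t r by (simp add: powr_powr)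
  qed
  have norm_eq: "Lr_norm r (count_space {1..}) z =
      (if ?f summable_on {1..} then ereal (infsum ?f {1..} powr (1 / r)) else \<infinity>)"
    unfolding Lr_norm_def int_iff using int_eq by auto
  show ?thesis
  proof
    assume le: "Lr_norm r (count_space {1..}) z \<le> ereal t"
    then have s: "?f summable_on {1..}"
      unfolding norm_eq by (auto split: if_splits)
    then have "infsum ?f {1..} powr (1 / r) \<le> t"
      using le unfolding norm_eq by (simp only: if_True ereal_less_eq)
    then have "infsum ?f {1..} \<le> t powr r"
      by (subst (asm) root_le) (auto intro: infsum_nonneg)
    then show "\<forall>F. finite F \<and> F \<subseteq> {1..} \<longrightarrow> sum ?f F \<le> t powr r"
      using finite_sum_le_infsum[OF s] by (auto intro: order_trans)
  next
    assume le: "\<forall>F. finite F \<and> F \<subseteq> {1..} \<longrightarrow> sum ?f F \<le> t powr r"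
    have s: "?f summable_on {1..}"
      by (rule nonneg_bounded_partial_sums_imp_summable_on[where C = "t powr r"])
        (use le in \<open>auto intro!: eventually_finite_subsets_at_top_weakI\<close>)
    have "infsum ?f {1..} \<le> t powr r"
      by (rule infsum_le_finite_sums[OF s]) (use le in auto)
    then have "infsum ?f {1..} powr (1 / r) \<le> t"
      by (subst root_le) (auto intro: infsum_nonneg)
    then show "Lr_norm r (count_space {1..}) z \<le> ereal t"
      unfolding norm_eq using s by (simp only: if_True ereal_less_eq)
  qed
qed

lemma Lr_norm_le_imp:
  assumes "0 < r" "0 \<le> \<epsilon>" "Lr_norm r M g \<le> ereal \<epsilon>"
  shows "integrable M (\<lambda>x. \<bar>g x\<bar> powr r)" "(\<integral>x. \<bar>g x\<bar> powr r \<partial>M) \<le> \<epsilon> powr r"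
proof -
  show int: "integrable M (\<lambda>x. \<bar>g x\<bar> powr r)"
    using assms(3) by (auto simp: Lr_norm_def split: if_splits)
  then have "(\<integral>x. \<bar>g x\<bar> powr r \<partial>M) powr (1 / r) \<le> \<epsilon>"
    using assms(3) by (simp add: Lr_norm_def)
  then have "((\<integral>x. \<bar>g x\<bar> powr r \<partial>M) powr (1 / r)) powr r \<le> \<epsilon> powr r"
    using assms(1) by (intro powr_mono2) auto
  then show "(\<integral>x. \<bar>g x\<bar> powr r \<partial>M) \<le> \<epsilon> powr r"
    using assms(1) by (simp add: powr_powr)
qed

text \<open>The exponent \<open>1/p\<close> as a real number, with \<open>1/\<infinity> = 0\<close>, so that it can be used in powers.\<close>

definition recip :: "ereal \<Rightarrow> real" where
  "recip p = real_of_ereal (1 / p)"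

lemma recip_ereal: "recip (ereal r) = 1 / r" if "1 \<le> r" 
  using that by (simp add: recip_def one_ereal_def)

lemma recip_infinity: "recip \<infinity> = 0"
  by (simp add: recip_def)

lemma exponent_cases:
  assumes "1 \<le> (p :: ereal)"
  obtains "p = \<infinity>" | r where "p = ereal r" "1 \<le> r"
  using assms by (cases p) (auto simp: one_ereal_def)

lemma lp_unit_ball_iff:
  assumes "1 \<le> r"
  shows "lp_norm (ereal r) z \<le> 1 \<longleftrightarrow>
    (\<forall>F. finite F \<and> F \<subseteq> {1..} \<longrightarrow> (\<Sum>j\<in>F. \<bar>z j\<bar> powr r) \<le> 1)"
  using Lr_norm_count_le_iff[of r 1 z] assms by (simp add: lp_norm_def one_ereal_def)

lemma linf_unit_ball_iff: "lp_norm \<infinity> z \<le> 1 \<longleftrightarrow> (\<forall>m\<ge>1. \<bar>z m\<bar> \<le> 1)"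
  by (auto simp: lp_norm_def SUP_le_iff one_ereal_def)

lemma lp_unit_ball_entry_le:
  assumes "1 \<le> p" "lp_norm p z \<le> 1" "1 \<le> m"
  shows "\<bar>z m\<bar> \<le> 1"
  using assms(1)
proof (cases p rule: exponent_cases)
  case (2 r)
  then have "\<bar>z m\<bar> powr r \<le> 1"
    using assms lp_unit_ball_iff[of r z] by (auto dest!: spec[of _ "{m}"])
  then have "(\<bar>z m\<bar> powr r) powr (1 / r) \<le> 1 powr (1 / r)" using 2 by (intro powr_mono2) auto
  then show ?thesis using 2 by (simp add: powr_powr)
qed (use assms linf_unit_ball_iff in auto)

lemma lp_unit_ball_mono:
  assumes "1 \<le> p" "lp_norm p z \<le> 1" "\<And>m. 1 \<le> m \<Longrightarrow> \<bar>x m\<bar> \<le> \<bar>z m\<bar>"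
  shows "lp_norm p x \<le> 1"
  using assms(1)
proof (cases p rule: exponent_cases)
  case 1
  then show ?thesis using assms by (auto simp: linf_unit_ball_iff intro: order_trans)
next
  case (2 r)
  show ?thesis unfolding 2(1) lp_unit_ball_iff[OF 2(2)]
  proof (intro allI impI)
    fix F :: "nat set" assume F: "finite F \<and> F \<subseteq> {1..}"
    have "(\<Sum>j\<in>F. \<bar>x j\<bar> powr r) \<le> (\<Sum>j\<in>F. \<bar>z j\<bar> powr r)"
      by (intro sum_mono powr_mono2) (use F 2 assms in auto)
    also have "\<dots> \<le> 1" using assms(2) F lp_unit_ball_iff[OF 2(2)] 2 by auto
    finally show "(\<Sum>j\<in>F. \<bar>x j\<bar> powr r) \<le> 1" .
  qed
qed

text \<open>For the packing argument: with entries of this size, such vectors are the longest ones of the unit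
  ball with \<open>N\<close> equal entries.\<close>

lemma lp_unit_ball_flat:
  assumes "1 \<le> p" "1 \<le> N" "\<And>m. m \<in> {1..N} \<Longrightarrow> \<bar>z m\<bar> \<le> real N powr - recip p"
    "\<And>m. m \<notin> {1..N} \<Longrightarrow> z m = 0"
  shows "lp_norm p z \<le> 1"
  using assms(1)
proof (cases p rule: exponent_cases)
  case 1
  have "\<bar>z m\<bar> \<le> 1" for m
    using assms(2) assms(3)[of m] assms(4)[of m] 1 by (cases "m \<in> {1..N}") (auto simp: recip_infinity)
  then show ?thesis using 1 by (auto simp: linf_unit_ball_iff)
next
  case (2 r)
  show ?thesis unfolding 2(1) lp_unit_ball_iff[OF 2(2)]
  proof (intro allI impI)
    fix F :: "nat set" assume F: "finite F \<and> F \<subseteq> {1..}"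
    have "(\<Sum>j\<in>F. \<bar>z j\<bar> powr r) = (\<Sum>j\<in>F \<inter> {1..N}. \<bar>z j\<bar> powr r)"
      using F assms(4) by (intro sum.mono_neutral_right) auto
    also have "\<dots> \<le> (\<Sum>j\<in>F \<inter> {1..N}. 1 / real N)"
    proof (rule sum_mono)
      fix j assume j: "j \<in> F \<inter> {1..N}"
      have "\<bar>z j\<bar> powr r \<le> (real N powr - recip p) powr r"
        using assms(3)[of j] j 2 by (intro powr_mono2) auto
      also have "\<dots> = 1 / real N"
      proof -
        have "- recip p * r = - 1" using 2 by (simp add: recip_ereal)
        then show ?thesis using assms(2) by (simp only: powr_powr) (simp add: powr_minus_divide)
      qed
      finally show "\<bar>z j\<bar> powr r \<le> 1 / real N" .
    qed
    also have "\<dots> \<le> (\<Sum>j\<in>{1..N}. 1 / real N)"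
      by (rule sum_mono2) auto
    also have "\<dots> = 1" using assms(2) by simp
    finally show "(\<Sum>j\<in>F. \<bar>z j\<bar> powr r) \<le> 1" .
  qed
qed

text \<open>The only property of the \<open>\<ell>\<^sub>p\<close>-ball that the net construction needs besides \<open>|z\<^sub>m| \<le> 1\<close>. After
  rescaling by \<open>n\<^sup>1\<^sup>/\<^sup>p\<close>, entries exceeding \<open>1\<close> are bounded by their \<open>p\<close>-th powers, which sum to
  at most \<open>n\<close>; for \<open>p = \<infinity>\<close> there are no such entries. This makes one argument serve all \<open>p\<close>.\<close>

lemma lp_unit_ball_large_entries:
  assumes "1 \<le> p" "lp_norm p z \<le> 1" "finite F" "F \<subseteq> {1..}" "1 \<le> n"
  shows "(\<Sum>m\<in>F. if 1 < real n powr recip p * \<bar>z m\<bar> then real n powr recip p * \<bar>z m\<bar> else 0) \<le> real n"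
  using assms(1)
proof (cases p rule: exponent_cases)
  case 1
  have "(if 1 < real n powr recip p * \<bar>z m\<bar> then real n powr recip p * \<bar>z m\<bar> else 0) = 0" if "m \<in> F" for m
    using lp_unit_ball_entry_le[OF assms(1,2), of m] that assms(4,5) 1 by (auto simp: recip_infinity)
  then show ?thesis by simp
next
  case (2 r)
  have "(\<Sum>m\<in>F. if 1 < real n powr recip p * \<bar>z m\<bar> then real n powr recip p * \<bar>z m\<bar> else 0)
    \<le> (\<Sum>m\<in>F. real n * \<bar>z m\<bar> powr r)"
  proof (rule sum_mono)
    fix m
    let ?t = "real n powr recip p * \<bar>z m\<bar>"
    have "?t powr r = real n * \<bar>z m\<bar> powr r"
      using 2 assms(5) by (simp add: powr_mult powr_powr recip_ereal)
    moreover have "?t \<le> ?t powr r" if "1 < ?t"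
      using that 2 powr_mono[of 1 r ?t] by simp
    ultimately show "(if 1 < ?t then ?t else 0) \<le> real n * \<bar>z m\<bar> powr r"
      by auto
  qed
  also have "\<dots> = real n * (\<Sum>m\<in>F. \<bar>z m\<bar> powr r)" by (simp add: sum_distrib_left)
  also have "\<dots> \<le> real n * 1"
    using assms lp_unit_ball_iff[OF 2(2), of z] 2 by (intro mult_left_mono) auto
  finally show ?thesis by simp
qed

lemma l2_norm_le_iff:
  assumes "0 \<le> t"
  shows "lp_norm 2 y \<le> ereal t \<longleftrightarrow> (\<forall>J. L2_set y {1..J} \<le> t)"
proof -
  have "lp_norm 2 y \<le> ereal t \<longleftrightarrow> (\<forall>F. finite F \<and> F \<subseteq> {1..} \<longrightarrow> (\<Sum>j\<in>F. (y j)\<^sup>2) \<le> t\<^sup>2)"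
    using Lr_norm_count_le_iff[of 2 t y] assms by (simp add: lp_norm_def powr_numeral)
  also have "\<dots> \<longleftrightarrow> (\<forall>J. (\<Sum>j\<in>{1..J}. (y j)\<^sup>2) \<le> t\<^sup>2)"
  proof (intro iffI allI impI)
    fix F :: "nat set" assume *: "\<forall>J. (\<Sum>j\<in>{1..J}. (y j)\<^sup>2) \<le> t\<^sup>2" and F: "finite F \<and> F \<subseteq> {1..}"
    have "(\<Sum>j\<in>F. (y j)\<^sup>2) \<le> (\<Sum>j\<in>{1..Max (insert 0 F)}. (y j)\<^sup>2)"
      using F by (intro sum_mono2) auto
    then show "(\<Sum>j\<in>F. (y j)\<^sup>2) \<le> t\<^sup>2" using * by (auto intro: order_trans)
  qed auto
  also have "\<dots> \<longleftrightarrow> (\<forall>J. L2_set y {1..J} \<le> t)"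
    using assms by (auto simp: L2_set_def intro: real_le_lsqrt dest: sqrt_le_D)
  finally show ?thesis .
qed

lemma mem_l2_iff: "y \<in> lp_space 2 \<longleftrightarrow> (\<exists>t. \<forall>J. L2_set y {1..J} \<le> t)"
proof
  assume "y \<in> lp_space 2"
  then have lt: "lp_norm 2 y < \<infinity>" by (simp add: lp_space_def)
  then obtain s where s: "lp_norm 2 y = ereal s"
    by (auto simp: lp_norm_def Lr_norm_def split: if_splits)
  then have "lp_norm 2 y \<le> ereal (max s 0)" by simp
  then show "\<exists>t. \<forall>J. L2_set y {1..J} \<le> t"
    by (subst (asm) l2_norm_le_iff) auto
next
  assume "\<exists>t. \<forall>J. L2_set y {1..J} \<le> t"
  then obtain t where t: "\<forall>J. L2_set y {1..J} \<le> t" by blast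
  have "0 \<le> t" using t[rule_format, of 0] by simp
  then have "lp_norm 2 y \<le> ereal t" using t l2_norm_le_iff by blast
  then show "y \<in> lp_space 2" by (auto simp: lp_space_def intro: le_less_trans)
qed

lemma finite_support_mem_l2:
  assumes "\<And>j. J < j \<Longrightarrow> y j = 0"
  shows "y \<in> lp_space 2"
proof -
  have "L2_set y {1..J'} \<le> L2_set y {1..J}" for J'
  proof -
    have "(\<Sum>j\<in>{1..J'}. (y j)\<^sup>2) = (\<Sum>j\<in>{1..J'} \<inter> {1..J}. (y j)\<^sup>2)"
      using assms by (intro sum.mono_neutral_right) auto
    also have "\<dots> \<le> (\<Sum>j\<in>{1..J}. (y j)\<^sup>2)" by (intro sum_mono2) auto
    finally show ?thesis by (simp add: L2_set_def)
  qed
  then show ?thesis unfolding mem_l2_iff by blast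
qed

section \<open>Nets for diagonal operators\<close>

text \<open>The right-hand side is the full geometric series over all integers.\<close>

lemma sum_exp_abs_int_le:
  fixes s :: real
  assumes "0 < s"
  shows "(\<Sum>k\<in>{- int R..int R}. exp (- (real_of_int \<bar>k\<bar> * s))) \<le> 1 + 2 / (exp s - 1)"
proof -
  have e: "exp s > 1" using assms by simp
  have "(\<Sum>k\<in>{- int R..int R}. exp (- (real_of_int \<bar>k\<bar> * s))) = 1 + 2 * (1 - exp (- (real R * s))) / (exp s - 1)"
  proof (induction R)
    case (Suc R)
    have eq: "{- int (Suc R)..int (Suc R)} = insert (int (Suc R)) (insert (- int (Suc R)) {- int R..int R})"
      by auto
    have "exp (- (real R * s)) = exp (- (real (Suc R) * s)) * exp s"
      by (simp add: exp_add[symmetric] algebra_simps)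
    then show ?case unfolding eq using e Suc
      by (simp add: field_simps)
  qed simp
  also have "\<dots> \<le> 1 + 2 / (exp s - 1)"
    using e by (intro add_left_mono divide_right_mono) auto
  finally show ?thesis .
qed

text \<open>Exponential weights: on \<open>K\<close> the weight \<open>exp (A - \<Sum> |k\<^sub>m| s\<^sub>m)\<close> is at least one, and its sum over
  all integer vectors factorises over the coordinates.\<close>

lemma card_weighted_l1_ball_le:
  fixes s :: "'i \<Rightarrow> real" and A :: real and R :: nat
  assumes F: "finite F" and s: "\<And>m. m \<in> F \<Longrightarrow> 0 < s m"
  defines "K \<equiv> {k \<in> F \<rightarrow>\<^sub>E {- int R..int R}. (\<Sum>m\<in>F. real_of_int \<bar>k m\<bar> * s m) \<le> A}"
  shows "real (card K) \<le> exp A * (\<Prod>m\<in>F. 1 + 2 / (exp (s m) - 1))"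
proof -
  have fin: "finite (F \<rightarrow>\<^sub>E {- int R..int R})" using F by (intro finite_PiE) auto
  have "real (card K) = (\<Sum>k\<in>K. 1)" by simp
  also have "\<dots> \<le> (\<Sum>k\<in>K. exp (A - (\<Sum>m\<in>F. real_of_int \<bar>k m\<bar> * s m)))"
    by (rule sum_mono) (auto simp: K_def)
  also have "\<dots> \<le> (\<Sum>k\<in>F \<rightarrow>\<^sub>E {- int R..int R}. exp (A - (\<Sum>m\<in>F. real_of_int \<bar>k m\<bar> * s m)))"
    by (rule sum_mono2[OF fin]) (auto simp: K_def)
  also have "\<dots> = (\<Sum>k\<in>F \<rightarrow>\<^sub>E {- int R..int R}. exp A * (\<Prod>m\<in>F. exp (- (real_of_int \<bar>k m\<bar> * s m))))"
  proof (rule sum.cong[OF refl])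
    fix k :: "'i \<Rightarrow> int"
    show "exp (A - (\<Sum>m\<in>F. real_of_int \<bar>k m\<bar> * s m)) = exp A * (\<Prod>m\<in>F. exp (- (real_of_int \<bar>k m\<bar> * s m)))"
      using exp_sum[OF F, of "\<lambda>m. - (real_of_int \<bar>k m\<bar> * s m)"]
      by (simp add: exp_diff exp_minus divide_inverse sum_negf)
  qed
  also have "\<dots> = exp A * (\<Prod>m\<in>F. \<Sum>k\<in>{- int R..int R}. exp (- (real_of_int \<bar>k\<bar> * s m)))"
    using F by (subst prod_sum_PiE) (auto simp: sum_distrib_left)
  also have "\<dots> \<le> exp A * (\<Prod>m\<in>F. 1 + 2 / (exp (s m) - 1))"
    by (intro mult_left_mono prod_mono conjI sum_exp_abs_int_le sum_nonneg s) auto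
  finally show ?thesis .
qed

lemma truncate_to_grid:
  fixes t \<delta> :: real
  assumes "0 < \<delta>"
  obtains k :: int where "real_of_int \<bar>k\<bar> * \<delta> \<le> \<bar>t\<bar>" "\<bar>t - real_of_int k * \<delta>\<bar> \<le> \<delta>"
proof -
  define l where "l = \<lfloor>\<bar>t\<bar> / \<delta>\<rfloor>"
  have l: "0 \<le> l" "real_of_int l \<le> \<bar>t\<bar> / \<delta>" "\<bar>t\<bar> / \<delta> < real_of_int l + 1"
    using assms by (auto simp: l_def)
  then have "real_of_int l * \<delta> \<le> \<bar>t\<bar>" "\<bar>t\<bar> < real_of_int l * \<delta> + \<delta>" "0 \<le> real_of_int l * \<delta>"
    using assms by (auto simp: field_simps)
  then show thesis
    using l(1) by (intro that[of "if t \<ge> 0 then l else - l"]) (auto simp: abs_if split: if_splits)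
qed

text \<open>The width of the grid for a coordinate with diagonal entry \<open>\<rho>\<close>. For \<open>\<rho> \<ge> 1\<close> the rounding error after
  multiplication by \<open>\<rho>\<close> stays constant. For \<open>\<rho> < 1\<close> the width exceeds \<open>1\<close>, so that few coordinates
  are rounded to nonzero values, while the exponent is chosen such that the squared error is still as
  small as \<open>\<rho>\<^sup>\<gamma>\<close>.\<close>

definition grid_step :: "real \<Rightarrow> real \<Rightarrow> real" where
  "grid_step \<gamma> \<rho> = (if 1 \<le> \<rho> then 1 / \<rho> else \<rho> powr - (1 - \<gamma> / 2))"

lemma grid_step_pos: "0 < \<rho> \<Longrightarrow> 0 < grid_step \<gamma> \<rho>"
  by (simp add: grid_step_def)

lemma grid_step_gt_1:
  assumes "\<gamma> < 2" "0 < \<rho>" "\<rho> < 1"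
  shows "1 < grid_step \<gamma> \<rho>"
proof -
  have "\<rho> powr 0 < \<rho> powr - (1 - \<gamma> / 2)"
    using assms by (intro powr_less_mono') auto
  then show ?thesis using assms by (simp add: grid_step_def)
qed

lemma grid_step_error:
  assumes "1 \<le> \<gamma>" "0 < \<rho>"
  shows "(\<rho> * grid_step \<gamma> \<rho>)\<^sup>2 \<le> 2 * ln (1 + \<rho> powr \<gamma>)"
proof (cases "1 \<le> \<rho>")
  case True
  have "1 \<le> 2 * ln (1 + 1 :: real)" by (rule le_two_ln_1p) auto
  also have "\<dots> \<le> 2 * ln (1 + \<rho> powr \<gamma>)"
    using ge_one_powr_ge_zero[OF True, of \<gamma>] assms by (intro mult_left_mono) (auto simp: add_pos_nonneg)
  finally show ?thesis using True assms by (simp add: grid_step_def)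
next
  case False
  have "\<rho> * \<rho> powr - (1 - \<gamma> / 2) = \<rho> powr (\<gamma> / 2)"
    using assms by (simp add: powr_mult_base)
  moreover have "(\<rho> powr (\<gamma> / 2))\<^sup>2 = \<rho> powr \<gamma>"
    using assms by (simp add: power2_eq_square powr_add[symmetric])
  moreover have "\<rho> powr \<gamma> \<le> 2 * ln (1 + \<rho> powr \<gamma>)"
    using False assms by (intro le_two_ln_1p) (auto intro: powr_le1)
  ultimately show ?thesis using False by (simp add: grid_step_def)
qed

text \<open>The left-hand side is the contribution of one coordinate to the logarithm of the number of grid
  vectors. For \<open>\<rho> \<ge> 1\<close> it is of the order of \<open>ln (1 + \<rho>)\<close>, as there are about \<open>\<rho>\<close> grid points
  per unit length. For \<open>\<rho> < 1\<close> it is exponentially small in a negative power of \<open>\<rho>\<close>, in particular of smaller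
  order than \<open>\<rho>\<^sup>\<gamma>\<close>.\<close>

lemma grid_step_count:
  assumes "1 \<le> \<gamma>" "\<gamma> < 2"
  obtains C where "0 < C"
    "\<And>\<rho>. 0 < \<rho> \<Longrightarrow> ln (1 + 2 / (exp (grid_step \<gamma> \<rho>) - 1)) \<le> C * ln (1 + \<rho> powr \<gamma>)"
proof
  \<comment> \<open>The degree \<open>L\<close> makes \<open>s\<^sup>-\<^sup>L\<close>, a power of \<open>\<rho>\<close> with exponent \<open>x L\<close>, at most \<open>\<rho>\<^sup>\<gamma>\<close> for \<open>\<rho> < 1\<close>.\<close>
  define x where "x = 1 - \<gamma> / 2"
  define L where "L = nat \<lceil>\<gamma> / x\<rceil>"
  have x: "0 < x" using assms by (simp add: x_def)
  have "0 < \<gamma> / x" using x assms by simp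
  then have L: "1 \<le> L" "\<gamma> / x \<le> real L" unfolding L_def by linarith+
  have xL: "\<gamma> \<le> x * real L" using L(2) x by (simp add: field_simps)
  define K where "K = 2 * real L ^ L"
  have K: "0 < K" using L by (simp add: K_def)
  show "0 < 2 + 2 * K" using K by simp
  fix \<rho> :: real assume \<rho>: "0 < \<rho>"
  let ?s = "grid_step \<gamma> \<rho>" and ?\<Phi> = "ln (1 + \<rho> powr \<gamma>)"
  have \<Phi>: "0 \<le> ?\<Phi>" by (auto intro: ln_ge_zero)
  have s: "0 < ?s" using \<rho> by (rule grid_step_pos)
  show "ln (1 + 2 / (exp ?s - 1)) \<le> (2 + 2 * K) * ?\<Phi>"
  proof (cases "1 \<le> \<rho>")
    case True
    have "?s \<le> exp ?s - 1" using exp_ge_add_one_self[of ?s] by linarith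
    then have "2 / (exp ?s - 1) \<le> 2 / ?s"
      using s by (intro divide_left_mono) (auto intro!: mult_pos_pos)
    then have "1 + 2 / (exp ?s - 1) \<le> 1 + 2 * \<rho>" using True by (simp add: grid_step_def)
    also have "\<dots> \<le> (1 + \<rho>)\<^sup>2" by (simp add: power2_eq_square algebra_simps)
    also have "\<dots> \<le> (1 + \<rho> powr \<gamma>)\<^sup>2"
      using True assms powr_mono[of 1 \<gamma> \<rho>] by (intro power_mono) auto
    finally have "ln (1 + 2 / (exp ?s - 1)) \<le> ln ((1 + \<rho> powr \<gamma>)\<^sup>2)"
    proof (subst ln_le_cancel_iff)
      show "0 < 1 + 2 / (exp ?s - 1)" using s by (intro add_pos_nonneg) auto
      show "0 < (1 + \<rho> powr \<gamma>)\<^sup>2" by (intro zero_less_power add_pos_nonneg) auto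
    qed
    also have "\<dots> = 2 * ?\<Phi>" using \<rho> by (subst ln_realpow) (auto intro!: add_pos_nonneg)
    also have "\<dots> \<le> (2 + 2 * K) * ?\<Phi>" using \<Phi> K by (intro mult_right_mono) auto
    finally show ?thesis .
  next
    case False
    have "(?s / real L) ^ L \<le> exp ?s - 1" by (rule exp_minus_one_ge_power) (use s L in auto)
    then have "2 / (exp ?s - 1) \<le> 2 / (?s / real L) ^ L"
      using s L by (intro divide_left_mono) (auto intro!: mult_pos_pos)
    also have "\<dots> = K * (1 / ?s ^ L)" by (simp add: K_def power_divide)
    also have "1 / ?s ^ L = \<rho> powr (x * real L)"
    proof -
      have "?s ^ L = \<rho> powr (- (x * real L))"
        using False \<rho> by (simp add: grid_step_def x_def[symmetric] powr_realpow[symmetric] powr_powr)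
      then show ?thesis by (simp add: powr_minus_divide)
    qed
    also have "\<dots> \<le> \<rho> powr \<gamma>" using False \<rho> xL by (intro powr_mono') auto
    finally have "2 / (exp ?s - 1) \<le> K * \<rho> powr \<gamma>" using K by simp
    then have "ln (1 + 2 / (exp ?s - 1)) \<le> K * \<rho> powr \<gamma>"
      using s ln_add_one_self_le_self[of "2 / (exp ?s - 1)"] by simp
    also have "\<dots> \<le> K * (2 * ?\<Phi>)"
      using False \<rho> K assms by (intro mult_left_mono le_two_ln_1p) (auto intro: powr_le1)
    also have "\<dots> \<le> (2 + 2 * K) * ?\<Phi>" using \<Phi> by (simp add: algebra_simps)
    finally show ?thesis .
  qed
qed

text \<open>Both the squared error and the logarithm of the number of grid vectors are sums over the
  coordinates of quantities bounded by multiples of \<open>ln (1 + \<rho>\<^sub>m\<^sup>\<gamma>)\<close>, hence of order at most \<open>n\<close>. The bound on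
  \<open>\<Sum> |k\<^sub>m| s\<^sub>m\<close>, which makes the count finite, splits in the same way: a nonzero \<open>k\<^sub>m\<close> in a
  coordinate with \<open>\<rho>\<^sub>m < 1\<close> forces \<open>n\<^sup>1\<^sup>/\<^sup>p |z\<^sub>m| > 1\<close>.\<close>

lemma diagonal_net:
  assumes \<gamma>: "1 \<le> \<gamma>" "\<gamma> < 2" and H: "0 < H"
  obtains C where "0 < C"
    "\<And>n F \<rho> p. 1 \<le> n \<Longrightarrow> 1 \<le> p \<Longrightarrow> finite F \<Longrightarrow> F \<subseteq> {1..} \<Longrightarrow> (\<And>m. m \<in> F \<Longrightarrow> 0 < \<rho> m) \<Longrightarrow>
      (\<Sum>m\<in>F. ln (1 + \<rho> m powr \<gamma>)) \<le> H * real n \<Longrightarrow>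
      \<exists>X. finite X \<and> real (card X) \<le> exp (C * real n) \<and>
        (\<forall>z. lp_norm p z \<le> 1 \<longrightarrow> (\<exists>x\<in>X. (\<Sum>m\<in>F. (\<rho> m * (z m - x m))\<^sup>2) \<le> C * real n powr (1 - 2 * recip p)))"
proof -
  obtain C\<^sub>1 where C\<^sub>1: "0 < C\<^sub>1"
    "\<And>\<rho>. 0 < \<rho> \<Longrightarrow> ln (1 + 2 / (exp (grid_step \<gamma> \<rho>) - 1)) \<le> C\<^sub>1 * ln (1 + \<rho> powr \<gamma>)"
    using grid_step_count[OF \<gamma>] by blast
  define C where "C = 2 * H + 1 + C\<^sub>1 * H"
  have C: "0 < C" using C\<^sub>1 H by (simp add: C_def add_pos_pos)
  show thesis
  proof (rule that[OF C])
    fix n :: nat and F :: "nat set" and \<rho> :: "nat \<Rightarrow> real" and p :: ereal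
    assume n: "1 \<le> n" and p: "1 \<le> p" and F: "finite F" "F \<subseteq> {1..}"
      and \<rho>: "\<And>m. m \<in> F \<Longrightarrow> 0 < \<rho> m"
      and sum_le: "(\<Sum>m\<in>F. ln (1 + \<rho> m powr \<gamma>)) \<le> H * real n"
    define q where "q = recip p"
    define s where "s = (\<lambda>m. grid_step \<gamma> (\<rho> m))"
    have s: "0 < s m" if "m \<in> F" for m using \<rho>[OF that] by (simp add: s_def grid_step_pos)
    define \<delta> where "\<delta> = (\<lambda>m. real n powr - q * s m)"
    have \<delta>: "0 < \<delta> m" if "m \<in> F" for m using s[OF that] n by (simp add: \<delta>_def)
    \<comment> \<open>\<open>A\<close> bounds the weighted \<open>\<ell>\<^sub>1\<close>-norm of the rounded vectors: \<open>2 H n\<close> comes from coordinates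
      with \<open>\<rho> \<ge> 1\<close>, and \<open>n\<close> from large entries. \<open>R\<close> only makes the range of the entries finite.\<close>
    define A where "A = (2 * H + 1) * real n"
    define R where "R = nat \<lceil>\<Sum>m\<in>F. A / s m\<rceil>"
    have A: "0 < A" using H n by (simp add: A_def)
    define K where "K = {k \<in> F \<rightarrow>\<^sub>E {- int R..int R}. (\<Sum>m\<in>F. real_of_int \<bar>k m\<bar> * s m) \<le> A}"
    have "finite K" using F by (auto simp: K_def intro!: finite_PiE)
    define X where "X = (\<lambda>k m. real_of_int (k m) * \<delta> m) ` K"
    have card_X: "real (card X) \<le> exp (C * real n)"
    proof -
      have "real (card X) \<le> real (card K)"
        unfolding X_def by (simp add: card_image_le \<open>finite K\<close>)
      also have "\<dots> \<le> exp A * (\<Prod>m\<in>F. 1 + 2 / (exp (s m) - 1))"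
        unfolding K_def by (rule card_weighted_l1_ball_le) (use F s in \<open>auto intro: less_imp_le\<close>)
      also have "(\<Prod>m\<in>F. 1 + 2 / (exp (s m) - 1)) = exp (\<Sum>m\<in>F. ln (1 + 2 / (exp (s m) - 1)))"
        unfolding exp_sum[OF F(1)]
        by (intro prod.cong refl exp_ln[symmetric]) (use s in \<open>auto intro!: add_pos_nonneg intro: less_imp_le\<close>)
      also have "exp A * \<dots> = exp (A + (\<Sum>m\<in>F. ln (1 + 2 / (exp (s m) - 1))))"
        by (simp add: exp_add)
      also have "(\<Sum>m\<in>F. ln (1 + 2 / (exp (s m) - 1))) \<le> (\<Sum>m\<in>F. C\<^sub>1 * ln (1 + \<rho> m powr \<gamma>))"
        unfolding s_def by (intro sum_mono C\<^sub>1 \<rho>)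
      also have "\<dots> \<le> C\<^sub>1 * (H * real n)"
        unfolding sum_distrib_left[symmetric] using C\<^sub>1 sum_le by (intro mult_left_mono) auto
      finally show ?thesis by (simp add: A_def C_def algebra_simps)
    qed
    have net: "\<exists>x\<in>X. (\<Sum>m\<in>F. (\<rho> m * (z m - x m))\<^sup>2) \<le> C * real n powr (1 - 2 * recip p)"
      if z: "lp_norm p z \<le> 1" for z
    proof -
      have "\<exists>k :: int. real_of_int \<bar>k\<bar> * \<delta> m \<le> \<bar>z m\<bar> \<and> \<bar>z m - real_of_int k * \<delta> m\<bar> \<le> \<delta> m" if "m \<in> F" for m
        using truncate_to_grid[OF \<delta>[OF that], of "z m"] by metis
      then obtain k' where k': "\<And>m. m \<in> F \<Longrightarrow> real_of_int \<bar>k' m\<bar> * \<delta> m \<le> \<bar>z m\<bar>"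
          "\<And>m. m \<in> F \<Longrightarrow> \<bar>z m - real_of_int (k' m) * \<delta> m\<bar> \<le> \<delta> m"
        by metis
      define k :: "nat \<Rightarrow> int" where "k = restrict k' F"
      define t where "t = (\<lambda>m. real n powr q * \<bar>z m\<bar>)"
      have kt: "real_of_int \<bar>k m\<bar> * s m \<le> t m" if "m \<in> F" for m
      proof -
        have "real n powr q * (real_of_int \<bar>k' m\<bar> * \<delta> m) \<le> t m"
          unfolding t_def by (intro mult_left_mono k' that) auto
        moreover have "real n powr q * (real_of_int \<bar>k' m\<bar> * \<delta> m) = real_of_int \<bar>k' m\<bar> * s m"
          using n by (simp add: \<delta>_def powr_minus)
        ultimately have "real_of_int \<bar>k' m\<bar> * s m \<le> t m" by (simp only:)
        then show ?thesis using that by (simp add: k_def)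
      qed
      have coord: "real_of_int \<bar>k m\<bar> * s m \<le> 2 * ln (1 + \<rho> m powr \<gamma>) + (if 1 < t m then t m else 0)" if m: "m \<in> F" for m
      proof (cases "1 \<le> \<rho> m")
        case True
        have "1 \<le> 2 * ln (1 + \<rho> m powr \<gamma>)"
          using grid_step_error[OF \<gamma>(1) \<rho>[OF m]] True by (simp add: grid_step_def)
        moreover have "0 \<le> t m" by (simp add: t_def)
        ultimately show ?thesis using kt[OF m] by auto
      next
        case False
        have \<Phi>: "0 \<le> ln (1 + \<rho> m powr \<gamma>)" by (auto intro: ln_ge_zero)
        have "1 < s m" unfolding s_def using False \<rho>[OF m] \<gamma> by (intro grid_step_gt_1) auto
        then have "1 < t m" if "k m \<noteq> 0"
        proof -
          have "1 * s m \<le> real_of_int \<bar>k m\<bar> * s m"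
            using that s[OF m] by (intro mult_right_mono) linarith+
          then show ?thesis using kt[OF m] \<open>1 < s m\<close> by linarith
        qed
        then have "k m \<noteq> 0 \<Longrightarrow> (if 1 < t m then t m else 0) = t m" by simp
        moreover have "k m = 0 \<Longrightarrow> real_of_int \<bar>k m\<bar> * s m = 0" by simp
        moreover have "0 \<le> (if 1 < t m then t m else 0)" by simp
        ultimately show ?thesis using kt[OF m] \<Phi> by linarith
      qed
      have "(\<Sum>m\<in>F. real_of_int \<bar>k m\<bar> * s m) \<le> 
          2 * (\<Sum>m\<in>F. ln (1 + \<rho> m powr \<gamma>)) + (\<Sum>m\<in>F. if 1 < t m then t m else 0)"
        unfolding sum_distrib_left sum.distrib[symmetric] by (intro sum_mono coord)
      also have "\<dots> \<le> 2 * (H * real n) + real n"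
        unfolding t_def q_def
        by (intro add_mono mult_left_mono sum_le lp_unit_ball_large_entries p z F n) auto
      finally have total: "(\<Sum>m\<in>F. real_of_int \<bar>k m\<bar> * s m) \<le> A"
        by (simp add: A_def algebra_simps)
      have range: "k m \<in> {- int R..int R}" if m: "m \<in> F" for m
      proof -
        have "real_of_int \<bar>k m\<bar> * s m \<le> (\<Sum>m\<in>F. real_of_int \<bar>k m\<bar> * s m)"
          using m F s by (intro member_le_sum) (auto intro!: mult_nonneg_nonneg intro: less_imp_le)
        then have "real_of_int \<bar>k m\<bar> \<le> A / s m" using total s[OF m] by (simp add: field_simps)
        also have "\<dots> \<le> (\<Sum>m\<in>F. A / s m)"
          using m F s A by (intro member_le_sum) (auto intro: less_imp_le)
        also have "\<dots> \<le> real R" unfolding R_def by linarith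
        finally have "\<bar>k m\<bar> \<le> int R" by linarith
        then show ?thesis by auto
      qed
      have "k \<in> K" unfolding K_def using range total by (auto simp: k_def)
      moreover have "(\<Sum>m\<in>F. (\<rho> m * (z m - real_of_int (k m) * \<delta> m))\<^sup>2) \<le> C * real n powr (1 - 2 * recip p)"
      proof -
        have "(\<Sum>m\<in>F. (\<rho> m * (z m - real_of_int (k m) * \<delta> m))\<^sup>2)
            \<le> (\<Sum>m\<in>F. real n powr (- 2 * q) * (2 * ln (1 + \<rho> m powr \<gamma>)))"
        proof (rule sum_mono)
          fix m assume m: "m \<in> F"
          have "(\<rho> m * (z m - real_of_int (k m) * \<delta> m))\<^sup>2 = (\<rho> m)\<^sup>2 * \<bar>z m - real_of_int (k m) * \<delta> m\<bar>\<^sup>2"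
            by (simp add: power_mult_distrib)
          also have "\<dots> \<le> (\<rho> m)\<^sup>2 * (\<delta> m)\<^sup>2"
            using k'(2)[OF m] m by (intro mult_left_mono power_mono) (auto simp: k_def)
          also have "\<dots> = real n powr (- 2 * q) * (\<rho> m * s m)\<^sup>2"
          proof -
            have "real n powr (- 2 * q) = (real n powr - q)\<^sup>2"
              by (simp add: power2_eq_square powr_add[symmetric])
            then show ?thesis by (simp add: \<delta>_def power_mult_distrib)
          qed
          also have "\<dots> \<le> real n powr (- 2 * q) * (2 * ln (1 + \<rho> m powr \<gamma>))"
            unfolding s_def by (intro mult_left_mono grid_step_error \<gamma> \<rho> m) auto
          finally show "(\<rho> m * (z m - real_of_int (k m) * \<delta> m))\<^sup>2 \<le> real n powr (- 2 * q) * (2 * ln (1 + \<rho> m powr \<gamma>))" .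
        qed
        also have "\<dots> = real n powr (- 2 * q) * (2 * (\<Sum>m\<in>F. ln (1 + \<rho> m powr \<gamma>)))"
          by (simp add: sum_distrib_left)
        also have "\<dots> \<le> real n powr (- 2 * q) * (2 * (H * real n))"
          by (intro mult_left_mono sum_le) auto
        also have "\<dots> = 2 * H * real n powr (1 - 2 * q)"
          using n by (simp add: powr_diff powr_minus_divide)
        also have "\<dots> \<le> C * real n powr (1 - 2 * q)"
          using C\<^sub>1 H by (intro mult_right_mono) (auto simp: C_def)
        finally show ?thesis by (simp add: q_def)
      qed
      ultimately show ?thesis
        unfolding X_def by (intro bexI[of _ "\<lambda>m. real_of_int (k m) * \<delta> m"] imageI)
    qed
    have "finite X" unfolding X_def using \<open>finite K\<close> by simp
    then show "\<exists>X. finite X \<and> real (card X) \<le> exp (C * real n) \<and>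
        (\<forall>z. lp_norm p z \<le> 1 \<longrightarrow> (\<exists>x\<in>X. (\<Sum>m\<in>F. (\<rho> m * (z m - x m))\<^sup>2) \<le> C * real n powr (1 - 2 * recip p)))"
      using card_X net by blast
  qed
qed

section \<open>Entropy numbers of weighted composition operators\<close>

text \<open>Iterating the doubling condition along \<open>m, 2m, 4m, \<dots>\<close> up to \<open>n\<close> costs a constant factor per step,
  that is, a power of \<open>n/m\<close> altogether.\<close>

lemma doubling_growth:
  fixes f :: "nat \<Rightarrow> real"
  assumes pos: "\<And>n. 1 \<le> n \<Longrightarrow> 0 < f n"
    and mono: "mono_on {1..} f \<or> antimono_on {1..} f"
    and doubling: "same_order f (\<lambda>n. f (2 * n))"
  obtains M B where "1 \<le> M" "0 < B"
    "\<And>m n. 1 \<le> m \<Longrightarrow> m \<le> n \<Longrightarrow> f m \<le> M * (real n / real m) powr B * f n"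
proof -
  have "limsup (\<lambda>n. ereal (f n / f (2 * n))) < \<infinity>" using doubling by (simp add: same_order_def)
  from limsup_finite_then_bounded[OF this] obtain D' where D': "\<And>n. f n / f (2 * n) \<le> D'" by blast
  define D where "D = max 2 D'"
  have D: "2 \<le> D" by (simp add: D_def)
  have step: "f n \<le> D * f (2 * n)" if "1 \<le> n" for n
  proof -
    have "f n / f (2 * n) \<le> D" using D'[of n] by (simp add: D_def)
    then show ?thesis using pos[of "2 * n"] that by (simp add: divide_simps)
  qed
  have iter: "f m \<le> D ^ r * f (2 ^ r * m)" if "1 \<le> m" for m r
  proof (induction r)
    case (Suc r)
    have "f (2 ^ r * m) \<le> D * f (2 * (2 ^ r * m))" using that by (intro step) auto
    then have "D ^ r * f (2 ^ r * m) \<le> D ^ r * (D * f (2 * (2 ^ r * m)))" using D by (intro mult_left_mono) auto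
    then show ?case using Suc by (simp add: mult_ac)
  qed simp
  define B where "B = log 2 D"
  have B: "0 < B" using D by (simp add: B_def)
  have DB: "D = 2 powr B" using D by (simp add: B_def)
  show thesis
  proof (rule that[of D B])
    show "1 \<le> D" using D by simp
    show "0 < B" by (rule B)
    fix m n :: nat assume m: "1 \<le> m" and mn: "m \<le> n"
    have ratio: "1 \<le> (real n / real m) powr B"
      using m mn B by (intro ge_one_powr_ge_zero) auto
    from mono show "f m \<le> D * (real n / real m) powr B * f n"
    proof
      assume "mono_on {1..} f"
      then have "f m \<le> 1 * f n" using m mn by (auto simp: monotone_on_def)
      also have "\<dots> \<le> D * (real n / real m) powr B * f n"
        using D ratio pos[of n] m mn mult_mono[of 1 D 1 "(real n / real m) powr B"]
        by (intro mult_right_mono) auto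
      finally show ?thesis .
    next
      assume anti: "antimono_on {1..} f"
      have "1 \<le> n div m" using m mn by (simp add: Suc_le_eq div_greater_zero_iff)
      then obtain r where r: "2 ^ r \<le> n div m" "n div m < 2 ^ (r + 1)"
        using ex_power_ivl1[of 2 "n div m"] by auto
      have r1: "2 ^ r * m \<le> n" using r(1) m
        by (meson div_times_less_eq_dividend le_trans mult_le_mono1)
      have r2: "n \<le> 2 ^ (r + 1) * m"
        using r(2) m by (metis div_less_iff_less_mult less_imp_le less_le_trans zero_less_one)
      have "f m \<le> D ^ (r + 1) * f (2 ^ (r + 1) * m)" by (rule iter[OF m])
      also have "\<dots> \<le> D ^ (r + 1) * f n"
        using anti r2 m mn D by (intro mult_left_mono) (auto simp: monotone_on_def)
      also have "\<dots> = D * (2 ^ r) powr B * f n"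
        using D by (simp add: DB powr_realpow[symmetric] powr_powr mult.commute)
      also have "\<dots> \<le> D * (real n / real m) powr B * f n"
      proof -
        have "real (2 ^ r * m) \<le> real n" using r1 by (simp only: of_nat_le_iff)
        then have "2 ^ r \<le> real n / real m" using m by (simp add: field_simps)
        then show ?thesis
          using D B pos[of n] m mn by (intro mult_right_mono mult_left_mono powr_mono2) auto
      qed
      finally show ?thesis .
    qed
  qed
qed

text \<open>The normalised diagonal entry at \<open>m\<close> collects all \<open>j\<close> with \<open>N j = m\<close>. Its possible excess over the
  case \<open>\<mu>\<^sub>m \<le> M \<mu>\<^sub>n\<close>, a power of \<open>n/m\<close> occurring for \<open>m < n\<close> only, is split off by
  \<open>1 + x y \<le> (1 + x) (1 + y)\<close>; subadditivity distributes the rest over the \<open>j\<close>.\<close>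

lemma sum_ln_1p_diagonal_le:
  fixes f \<mu> :: "nat \<Rightarrow> real" and N :: "nat \<Rightarrow> nat"
  assumes \<alpha>: "0 < \<alpha>" "\<alpha> < 2"
    and \<mu>_pos: "\<And>m. 1 \<le> m \<Longrightarrow> 0 < \<mu> m"
    and M: "1 \<le> M" and B: "0 < B"
    and up: "\<And>n m. 1 \<le> n \<Longrightarrow> n \<le> m \<Longrightarrow> \<mu> m \<le> M * \<mu> n"
    and down: "\<And>m n. 1 \<le> m \<Longrightarrow> m \<le> n \<Longrightarrow> \<mu> m \<le> M * (real n / real m) powr B * \<mu> n"
    and K: "0 < K"
    and N: "\<And>j. 1 \<le> j \<Longrightarrow> 1 \<le> N j"
    and f: "\<And>j. 1 \<le> j \<Longrightarrow> \<bar>f j\<bar> \<le> K * \<mu> (N j) * real j powr (- 1 / \<alpha>)"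
  shows "\<exists>H>0. \<forall>n J S. 1 \<le> n \<longrightarrow> S \<subseteq> {1..J} \<longrightarrow>
      (\<Sum>m\<in>N ` S. ln (1 + (sqrt (\<Sum>j | j \<in> S \<and> N j = m. (f j)\<^sup>2) / (\<mu> n * real n powr (- 1 / \<alpha>))) powr (1 + \<alpha> / 2)))
        \<le> H * real n"
proof -
  define \<gamma> where "\<gamma> = 1 + \<alpha> / 2"
  have \<gamma>: "1 \<le> \<gamma>" "\<gamma> < 2" "1 < \<gamma> / \<alpha>" using \<alpha> by (auto simp: \<gamma>_def field_simps)
  have KM: "0 < (K * M) powr \<gamma>" using K M by simp
  obtain H\<^sub>1 where H\<^sub>1: "0 < H\<^sub>1"
    "\<And>n J. 1 \<le> n \<Longrightarrow> (\<Sum>j=1..J. ln (1 + (K * M) powr \<gamma> * (real n / real j) powr (\<gamma> / \<alpha>))) \<le> H\<^sub>1 * real n"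
    using sum_ln_1p_powr_le[OF KM \<gamma>(3)] by blast
  \<comment> \<open>The exponent is raised by \<open>2\<close> to exceed \<open>1\<close>, which is harmless since \<open>n/m \<ge> 1\<close> where it is used.\<close>
  have "1 < B * \<gamma> + 2" using B \<gamma> by (simp add: add_pos_pos)
  then obtain H\<^sub>2 where H\<^sub>2: "0 < H\<^sub>2"
    "\<And>n J. 1 \<le> n \<Longrightarrow> (\<Sum>j=1..J. ln (1 + 1 * (real n / real j) powr (B * \<gamma> + 2))) \<le> H\<^sub>2 * real n"
    using sum_ln_1p_powr_le[of 1] by (metis zero_less_one)
  show ?thesis
  proof (intro exI[of _ "H\<^sub>1 + H\<^sub>2"] conjI allI impI)
    show "0 < H\<^sub>1 + H\<^sub>2" using H\<^sub>1 H\<^sub>2 by simp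
    fix n J :: nat and S :: "nat set" assume n: "1 \<le> n" and S: "S \<subseteq> {1..J}"
    have finS: "finite S" using S finite_subset by blast
    define \<tau> where "\<tau> = \<mu> n * real n powr (- 1 / \<alpha>)"
    have \<tau>: "0 < \<tau>" using \<mu>_pos[OF n] n by (simp add: \<tau>_def)
    define a where "a = (\<lambda>j. ((K * M) * (real n / real j) powr (1 / \<alpha>))\<^sup>2)"
    define I where "I = (\<lambda>m. {j. j \<in> S \<and> N j = m})"
    have finI: "finite (I m)" for m using finS by (simp add: I_def)
    define \<rho> where "\<rho> = (\<lambda>m. sqrt (\<Sum>j\<in>I m. (f j)\<^sup>2) / \<tau>)"
    define r where "r = (\<lambda>m. (\<Sum>j\<in>I m. a j) powr (\<gamma> / 2))"
    define g where "g = (\<lambda>m. if m < n then (real n / real m) powr (B * \<gamma> + 2) else 0)"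
    have bound: "ln (1 + \<rho> m powr \<gamma>) \<le> ln (1 + g m) + (\<Sum>j\<in>I m. ln (1 + a j powr (\<gamma> / 2)))"
      if "m \<in> N ` S" for m
    proof -
      have m: "1 \<le> m" using that N S by force
      define h where "h = (if m < n then (real n / real m) powr B else 1)"
      have h: "0 \<le> h" by (simp add: h_def)
      have "\<mu> m \<le> M * h * \<mu> n"
        using up[of n m] down[of m n] m n by (auto simp: h_def)
      have term_le: "(f j / \<tau>)\<^sup>2 \<le> h\<^sup>2 * a j" if "j \<in> I m" for j
      proof -
        have j: "1 \<le> j" "N j = m" using that S by (auto simp: I_def)
        have "\<bar>f j\<bar> \<le> K * \<mu> m * real j powr (- 1 / \<alpha>)" using f[OF j(1)] j(2) by simp
        also have "\<dots> \<le> K * (M * h * \<mu> n) * real j powr (- 1 / \<alpha>)"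
          using \<open>\<mu> m \<le> M * h * \<mu> n\<close> K by (intro mult_right_mono mult_left_mono) auto
        also have "\<dots> = h * ((K * M) * (real n / real j) powr (1 / \<alpha>)) * \<tau>"
          using n j by (simp add: \<tau>_def powr_divide powr_minus_divide)
        finally have "\<bar>f j / \<tau>\<bar> \<le> h * ((K * M) * (real n / real j) powr (1 / \<alpha>))"
          using \<tau> by (simp add: pos_divide_le_eq)
        then have "\<bar>f j / \<tau>\<bar>\<^sup>2 \<le> (h * ((K * M) * (real n / real j) powr (1 / \<alpha>)))\<^sup>2"
          by (intro power_mono) auto
        then show ?thesis unfolding a_def power_mult_distrib[of h, symmetric] power2_abs .
      qed
      have "\<rho> m = sqrt (\<Sum>j\<in>I m. (f j / \<tau>)\<^sup>2)"
        using \<tau> by (simp add: \<rho>_def power_divide sum_divide_distrib[symmetric] real_sqrt_divide)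
      also have "\<dots> \<le> sqrt (\<Sum>j\<in>I m. h\<^sup>2 * a j)"
        by (intro real_sqrt_le_mono sum_mono term_le)
      also have "\<dots> = h * sqrt (\<Sum>j\<in>I m. a j)"
        using h by (simp add: sum_distrib_left[symmetric] real_sqrt_mult)
      finally have "\<rho> m powr \<gamma> \<le> (h * sqrt (\<Sum>j\<in>I m. a j)) powr \<gamma>"
        using \<gamma> \<tau> by (intro powr_mono2) (auto simp: \<rho>_def sum_nonneg)
      also have "\<dots> = h powr \<gamma> * r m"
        using h by (simp add: powr_mult sum_nonneg a_def r_def powr_half_sqrt[symmetric] powr_powr)
      finally have \<rho>_le: "\<rho> m powr \<gamma> \<le> h powr \<gamma> * r m" .
      have r0: "0 \<le> r m" by (simp add: r_def)
      have g0: "0 \<le> g m" by (simp add: g_def)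
      have "1 + \<rho> m powr \<gamma> \<le> (1 + g m) * (1 + r m)"
      proof (cases "m < n")
        case True
        have "h powr \<gamma> \<le> g m"
          using True m n by (simp add: h_def g_def powr_powr powr_mono)
        then have "h powr \<gamma> * r m \<le> g m * r m" using r0 by (rule mult_right_mono)
        then show ?thesis using \<rho>_le r0 g0 by (simp add: algebra_simps)
      next
        case False
        then show ?thesis using \<rho>_le by (simp add: h_def g_def)
      qed
      then have "ln (1 + \<rho> m powr \<gamma>) \<le> ln ((1 + g m) * (1 + r m))"
        using r0 g0 by (subst ln_le_cancel_iff) (auto intro!: mult_pos_pos add_pos_nonneg)
      also have "\<dots> = ln (1 + g m) + ln (1 + r m)"
        using r0 g0 by (intro ln_mult_pos) auto
      also have "ln (1 + r m) \<le> (\<Sum>j\<in>I m. ln (1 + a j powr (\<gamma> / 2)))"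
        unfolding r_def using \<gamma> by (intro ln_1p_powr_sum_le finI) (auto simp: a_def)
      finally show ?thesis by simp
    qed
    have "(\<Sum>m\<in>N ` S. ln (1 + \<rho> m powr \<gamma>)) \<le>
        (\<Sum>m\<in>N ` S. ln (1 + g m)) + (\<Sum>m\<in>N ` S. \<Sum>j\<in>I m. ln (1 + a j powr (\<gamma> / 2)))"
      unfolding sum.distrib[symmetric] by (rule sum_mono) (rule bound)
    also have "(\<Sum>m\<in>N ` S. \<Sum>j\<in>I m. ln (1 + a j powr (\<gamma> / 2))) = (\<Sum>j\<in>S. ln (1 + a j powr (\<gamma> / 2)))"
      unfolding I_def by (rule sum.group) (use finS in auto)
    also have "\<dots> \<le> (\<Sum>j\<in>{1..J}. ln (1 + a j powr (\<gamma> / 2)))"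
      by (rule sum_mono2) (use S in \<open>auto intro: ln_ge_zero\<close>)
    also have "\<dots> = (\<Sum>j=1..J. ln (1 + (K * M) powr \<gamma> * (real n / real j) powr (\<gamma> / \<alpha>)))"
    proof (rule sum.cong[OF refl])
      fix j
      have "a j = ((K * M) * (real n / real j) powr (1 / \<alpha>)) powr 2"
        using K M by (simp add: a_def powr_numeral)
      then have "a j powr (\<gamma> / 2) = ((K * M) * (real n / real j) powr (1 / \<alpha>)) powr \<gamma>"
        by (simp add: powr_powr)
      also have "\<dots> = (K * M) powr \<gamma> * (real n / real j) powr (\<gamma> / \<alpha>)"
        using K M by (simp add: powr_mult powr_powr)
      finally show "ln (1 + a j powr (\<gamma> / 2)) = ln (1 + (K * M) powr \<gamma> * (real n / real j) powr (\<gamma> / \<alpha>))"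
        by simp
    qed
    also have "\<dots> \<le> H\<^sub>1 * real n" by (rule H\<^sub>1(2)[OF n])
    also have "(\<Sum>m\<in>N ` S. ln (1 + g m)) = (\<Sum>m\<in>N ` S \<inter> {1..n}. ln (1 + g m))"
    proof (rule sum.mono_neutral_right)
      show "\<forall>i\<in>N ` S - N ` S \<inter> {1..n}. ln (1 + g i) = 0"
      proof
        fix i assume i: "i \<in> N ` S - N ` S \<inter> {1..n}"
        then have "1 \<le> i" using N S by force
        then show "ln (1 + g i) = 0" using i by (auto simp: g_def)
      qed
    qed (use finS in auto)
    also have "\<dots> \<le> (\<Sum>m\<in>{1..n}. ln (1 + g m))"
      by (rule sum_mono2) (auto intro!: ln_ge_zero simp: g_def)
    also have "\<dots> \<le> (\<Sum>m=1..n. ln (1 + 1 * (real n / real m) powr (B * \<gamma> + 2)))"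
      by (rule sum_mono) (auto simp: g_def intro!: ln_ge_zero)
    also have "\<dots> \<le> H\<^sub>2 * real n" by (rule H\<^sub>2(2)[OF n])
    finally show "(\<Sum>m\<in>N ` S. ln (1 + (sqrt (\<Sum>j | j \<in> S \<and> N j = m. (f j)\<^sup>2) / (\<mu> n * real n powr (- 1 / \<alpha>))) powr (1 + \<alpha> / 2)))
        \<le> (H\<^sub>1 + H\<^sub>2) * real n"
      by (simp add: \<rho>_def I_def \<tau>_def \<gamma>_def algebra_simps)
  qed
qed

text \<open>Summability of \<open>j\<^sup>-\<^sup>2\<^sup>/\<^sup>\<alpha>\<close> allows all but finitely many coordinates of the image to be replaced by
  zero, which leaves a diagonal operator with finitely many entries.\<close>

lemma l2_net_of_weighted_composition:
  fixes f \<mu> :: "nat \<Rightarrow> real" and N :: "nat \<Rightarrow> nat"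
  assumes \<alpha>: "0 < \<alpha>" "\<alpha> < 2" and p: "1 \<le> p"
    and \<mu>_pos: "\<And>m. 1 \<le> m \<Longrightarrow> 0 < \<mu> m"
    and M: "1 \<le> M" and B: "0 < B"
    and up: "\<And>n m. 1 \<le> n \<Longrightarrow> n \<le> m \<Longrightarrow> \<mu> m \<le> M * \<mu> n"
    and down: "\<And>m n. 1 \<le> m \<Longrightarrow> m \<le> n \<Longrightarrow> \<mu> m \<le> M * (real n / real m) powr B * \<mu> n"
    and K: "0 < K"
    and N: "\<And>j. 1 \<le> j \<Longrightarrow> 1 \<le> N j"
    and f: "\<And>j. 1 \<le> j \<Longrightarrow> \<bar>f j\<bar> \<le> K * \<mu> (N j) * real j powr (- 1 / \<alpha>)"
  shows "\<exists>C>0. \<forall>n\<ge>1. \<exists>Y. finite Y \<and> Y \<subseteq> lp_space 2 \<and> real (card Y) \<le> exp (C * real n) \<and>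
      (\<forall>z. lp_norm p z \<le> 1 \<longrightarrow> (\<exists>y\<in>Y. \<forall>J. L2_set (\<lambda>j. f j * z (N j) - y j) {1..J}
        \<le> C * \<mu> n * real n powr (- 1 / \<alpha> + 1 / 2 - recip p)))"
proof -
  define \<gamma> where "\<gamma> = 1 + \<alpha> / 2"
  have \<gamma>: "1 \<le> \<gamma>" "\<gamma> < 2" using \<alpha> by (auto simp: \<gamma>_def)
  have "\<exists>H>0. \<forall>n J S. 1 \<le> n \<longrightarrow> S \<subseteq> {1..J} \<longrightarrow>
      (\<Sum>m\<in>N ` S. ln (1 + (sqrt (\<Sum>j | j \<in> S \<and> N j = m. (f j)\<^sup>2) / (\<mu> n * real n powr (- 1 / \<alpha>))) powr \<gamma>))
        \<le> H * real n"
    unfolding \<gamma>_def by (rule sum_ln_1p_diagonal_le[OF \<alpha> _ M B _ _ K]; fact)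
  then obtain H where H: "0 < H"
    "\<And>n J S. 1 \<le> n \<Longrightarrow> S \<subseteq> {1..J} \<Longrightarrow>
      (\<Sum>m\<in>N ` S. ln (1 + (sqrt (\<Sum>j | j \<in> S \<and> N j = m. (f j)\<^sup>2) / (\<mu> n * real n powr (- 1 / \<alpha>))) powr \<gamma>))
        \<le> H * real n"
    by blast
  obtain C\<^sub>1 where C\<^sub>1: "0 < C\<^sub>1"
    "\<And>n F \<rho> p. 1 \<le> n \<Longrightarrow> 1 \<le> p \<Longrightarrow> finite F \<Longrightarrow> F \<subseteq> {1..} \<Longrightarrow> (\<And>m. m \<in> F \<Longrightarrow> 0 < \<rho> m) \<Longrightarrow>
      (\<Sum>m\<in>F. ln (1 + \<rho> m powr \<gamma>)) \<le> H * real n \<Longrightarrow>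
      \<exists>X. finite X \<and> real (card X) \<le> exp (C\<^sub>1 * real n) \<and>
        (\<forall>z. lp_norm p z \<le> 1 \<longrightarrow> (\<exists>x\<in>X. (\<Sum>m\<in>F. (\<rho> m * (z m - x m))\<^sup>2) \<le> C\<^sub>1 * real n powr (1 - 2 * recip p)))"
    using diagonal_net[OF \<gamma> H(1)] by blast
  show ?thesis
  proof (intro exI[of _ "C\<^sub>1 + 1"] conjI allI impI)
    show "0 < C\<^sub>1 + 1" using C\<^sub>1 by simp
    fix n :: nat assume n: "1 \<le> n"
    define \<tau> where "\<tau> = \<mu> n * real n powr (- 1 / \<alpha>)"
    have \<tau>: "0 < \<tau>" using \<mu>_pos[OF n] n by (simp add: \<tau>_def)
    define \<epsilon> where "\<epsilon> = \<tau>\<^sup>2 * real n powr (1 - 2 * recip p)"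
    have \<epsilon>: "0 < \<epsilon>" using \<tau> n by (simp add: \<epsilon>_def)
    define k where "k = 2 / \<alpha>"
    have k: "1 < k" using \<alpha> by (simp add: k_def)
    define D where "D = (K * (M * \<mu> 1))\<^sup>2"
    have D: "0 < D" using K M \<mu>_pos[of 1] by (simp add: D_def)
    have f_sq: "(f j)\<^sup>2 \<le> D * real j powr - k" if j: "1 \<le> j" for j
    proof -
      have "\<bar>f j\<bar> \<le> K * \<mu> (N j) * real j powr (- 1 / \<alpha>)" by (rule f[OF j])
      also have "\<dots> \<le> K * (M * \<mu> 1) * real j powr (- 1 / \<alpha>)"
        using up[of 1 "N j"] N[OF j] K by (intro mult_right_mono mult_left_mono) auto
      finally have "\<bar>f j\<bar>\<^sup>2 \<le> (K * (M * \<mu> 1) * real j powr (- 1 / \<alpha>))\<^sup>2" by (intro power_mono) auto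
      also have "\<dots> = D * (real j powr (- 1 / \<alpha>))\<^sup>2" by (simp add: D_def power_mult_distrib)
      also have "(real j powr (- 1 / \<alpha>))\<^sup>2 = real j powr - k"
        by (simp add: power2_eq_square powr_add[symmetric] k_def)
      finally show ?thesis by simp
    qed
    \<comment> \<open>Coordinates beyond \<open>J\<^sub>0\<close> contribute no more than the error that is tolerated anyway.\<close>
    obtain J\<^sub>0 where J\<^sub>0: "1 \<le> J\<^sub>0" "\<And>J. (\<Sum>j=Suc J\<^sub>0..J. (f j)\<^sup>2) \<le> \<epsilon>"
    proof -
      have "((\<lambda>J. D * (real J powr (1 - k) / (k - 1))) \<longlongrightarrow> D * (0 / (k - 1))) sequentially"
        using k by (intro tendsto_intros tendsto_neg_powr filterlim_real_sequentially) auto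
      then have "\<forall>\<^sub>F J in sequentially. D * (real J powr (1 - k) / (k - 1)) < \<epsilon>"
        using \<epsilon> by (auto dest: order_tendstoD(2))
      then have "\<forall>\<^sub>F J in sequentially. D * (real J powr (1 - k) / (k - 1)) < \<epsilon> \<and> 1 \<le> J"
        using eventually_ge_at_top by (rule eventually_conj)
      then obtain J\<^sub>0 where *: "D * (real J\<^sub>0 powr (1 - k) / (k - 1)) < \<epsilon>" "1 \<le> J\<^sub>0"
        unfolding eventually_sequentially by auto
      have "(\<Sum>j=Suc J\<^sub>0..J. (f j)\<^sup>2) \<le> \<epsilon>" for J
      proof -
        have "(\<Sum>j=Suc J\<^sub>0..J. (f j)\<^sup>2) \<le> (\<Sum>j=Suc J\<^sub>0..J. D * real j powr - k)"
          by (intro sum_mono f_sq) auto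
        also have "\<dots> \<le> D * (real J\<^sub>0 powr (1 - k) / (k - 1))"
          unfolding sum_distrib_left[symmetric] using D k *(2) by (intro mult_left_mono sum_tail_powr_le) auto
        finally show ?thesis using *(1) by simp
      qed
      then show ?thesis using *(2) that by blast
    qed
    define S where "S = {j \<in> {1..J\<^sub>0}. f j \<noteq> 0}"
    have S: "S \<subseteq> {1..J\<^sub>0}" "finite S" by (auto simp: S_def)
    define F where "F = N ` S"
    have F: "finite F" "F \<subseteq> {1..}" using S N by (auto simp: F_def S_def)
    define \<rho> where "\<rho> = (\<lambda>m. sqrt (\<Sum>j | j \<in> S \<and> N j = m. (f j)\<^sup>2) / \<tau>)"
    have \<rho>_pos: "0 < \<rho> m" if "m \<in> F" for m
    proof -
      have "0 < (\<Sum>j | j \<in> S \<and> N j = m. (f j)\<^sup>2)"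
        using S(2) that by (intro sum_pos) (auto simp: F_def S_def)
      then show ?thesis using \<tau> by (simp add: \<rho>_def)
    qed
    have "(\<Sum>m\<in>F. ln (1 + \<rho> m powr \<gamma>)) \<le> H * real n"
      unfolding F_def \<rho>_def \<tau>_def by (rule H(2)[OF n S(1)])
    from C\<^sub>1(2)[OF n p F \<rho>_pos this] obtain X where X: "finite X" "real (card X) \<le> exp (C\<^sub>1 * real n)"
      "\<And>z. lp_norm p z \<le> 1 \<Longrightarrow> \<exists>x\<in>X. (\<Sum>m\<in>F. (\<rho> m * (z m - x m))\<^sup>2) \<le> C\<^sub>1 * real n powr (1 - 2 * recip p)"
      by blast
    define T where "T = (\<lambda>x j. if j \<in> S then f j * x (N j) else 0)"
    have "\<exists>y\<in>T ` X. \<forall>J. L2_set (\<lambda>j. f j * z (N j) - y j) {1..J}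
        \<le> (C\<^sub>1 + 1) * \<mu> n * real n powr (- 1 / \<alpha> + 1 / 2 - recip p)" if z: "lp_norm p z \<le> 1" for z
    proof -
      obtain x where x: "x \<in> X" "(\<Sum>m\<in>F. (\<rho> m * (z m - x m))\<^sup>2) \<le> C\<^sub>1 * real n powr (1 - 2 * recip p)"
        using X(3)[OF z] by blast
      define e where "e = (\<lambda>j. f j * z (N j) - T x j)"
      have head: "(\<Sum>j\<in>S. (e j)\<^sup>2) \<le> C\<^sub>1 * \<epsilon>"
      proof -
        have "(\<Sum>j\<in>S. (e j)\<^sup>2) = (\<Sum>j\<in>S. (f j)\<^sup>2 * (z (N j) - x (N j))\<^sup>2)"
          by (rule sum.cong) (auto simp: e_def T_def power_mult_distrib[symmetric] right_diff_distrib)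
        also have "\<dots> = (\<Sum>m\<in>F. \<Sum>j | j \<in> S \<and> N j = m. (f j)\<^sup>2 * (z (N j) - x (N j))\<^sup>2)"
          unfolding F_def by (rule sum.group[symmetric]) (use S in auto)
        also have "\<dots> = (\<Sum>m\<in>F. \<tau>\<^sup>2 * (\<rho> m * (z m - x m))\<^sup>2)"
        proof (rule sum.cong[OF refl])
          fix m
          have "(\<Sum>j | j \<in> S \<and> N j = m. (f j)\<^sup>2 * (z (N j) - x (N j))\<^sup>2)
              = (\<Sum>j | j \<in> S \<and> N j = m. (f j)\<^sup>2) * (z m - x m)\<^sup>2"
            unfolding sum_distrib_right by (rule sum.cong) auto
          also have "(\<Sum>j | j \<in> S \<and> N j = m. (f j)\<^sup>2) = \<tau>\<^sup>2 * (\<rho> m)\<^sup>2"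
            using \<tau> by (simp add: \<rho>_def power_divide sum_nonneg)
          finally show "(\<Sum>j | j \<in> S \<and> N j = m. (f j)\<^sup>2 * (z (N j) - x (N j))\<^sup>2) = \<tau>\<^sup>2 * (\<rho> m * (z m - x m))\<^sup>2"
            by (simp add: power_mult_distrib)
        qed
        also have "\<dots> \<le> \<tau>\<^sup>2 * (C\<^sub>1 * real n powr (1 - 2 * recip p))"
          unfolding sum_distrib_left[symmetric] by (intro mult_left_mono x) auto
        finally show ?thesis by (simp add: \<epsilon>_def mult_ac)
      qed
      have "L2_set e {1..J} \<le> (C\<^sub>1 + 1) * \<mu> n * real n powr (- 1 / \<alpha> + 1 / 2 - recip p)" for J
      proof -
        have "(\<Sum>j\<in>{1..J}. (e j)\<^sup>2) = (\<Sum>j\<in>{1..J} \<inter> (S \<union> {Suc J\<^sub>0..J}). (e j)\<^sup>2)"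
          by (rule sum.mono_neutral_right) (auto simp: e_def S_def T_def)
        also have "\<dots> \<le> (\<Sum>j\<in>S \<union> {Suc J\<^sub>0..J}. (e j)\<^sup>2)"
          using S by (intro sum_mono2) auto
        also have "\<dots> = (\<Sum>j\<in>S. (e j)\<^sup>2) + (\<Sum>j=Suc J\<^sub>0..J. (e j)\<^sup>2)"
          using S by (intro sum.union_disjoint) (auto simp: S_def)
        also have "(\<Sum>j=Suc J\<^sub>0..J. (e j)\<^sup>2) \<le> (\<Sum>j=Suc J\<^sub>0..J. (f j)\<^sup>2)"
        proof (rule sum_mono)
          fix j assume j: "j \<in> {Suc J\<^sub>0..J}"
          have "\<bar>z (N j)\<bar> \<le> 1" using j N[of j] by (intro lp_unit_ball_entry_le[OF p z]) auto
          then have "(z (N j))\<^sup>2 \<le> 1" by (simp add: abs_square_le_1)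
          then have "(f j)\<^sup>2 * (z (N j))\<^sup>2 \<le> (f j)\<^sup>2 * 1" by (intro mult_left_mono) auto
          then show "(e j)\<^sup>2 \<le> (f j)\<^sup>2" using j by (simp add: e_def T_def S_def power_mult_distrib)
        qed
        also have "\<dots> \<le> \<epsilon>" by (rule J\<^sub>0)
        finally have "(\<Sum>j\<in>{1..J}. (e j)\<^sup>2) \<le> (C\<^sub>1 + 1) * \<epsilon>" using head by (simp add: algebra_simps)
        then have "L2_set e {1..J} \<le> sqrt ((C\<^sub>1 + 1) * \<epsilon>)"
          unfolding L2_set_def by (rule real_sqrt_le_mono)
        also have "sqrt ((C\<^sub>1 + 1) * \<epsilon>) = sqrt (C\<^sub>1 + 1) * (\<tau> * real n powr (1 / 2 - recip p))"
        proof -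
          have "sqrt (real n powr (1 - 2 * recip p)) = real n powr (1 / 2 - recip p)"
            by (simp add: powr_half_sqrt[symmetric] powr_powr diff_divide_distrib)
          then show ?thesis using \<tau> by (simp add: \<epsilon>_def real_sqrt_mult)
        qed
        also have "\<dots> \<le> (C\<^sub>1 + 1) * (\<tau> * real n powr (1 / 2 - recip p))"
          using C\<^sub>1(1) \<tau> by (intro mult_right_mono real_le_lsqrt) (auto simp: power2_eq_square algebra_simps)
        also have "\<dots> = (C\<^sub>1 + 1) * \<mu> n * real n powr (- 1 / \<alpha> + 1 / 2 - recip p)"
          using n by (simp add: \<tau>_def powr_add powr_diff powr_minus_divide)
        finally show ?thesis .
      qed
      then show ?thesis using x(1) unfolding e_def by blast
    qed
    moreover have "T x \<in> lp_space 2" for x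
      by (rule finite_support_mem_l2[of J\<^sub>0]) (auto simp: T_def S_def)
    moreover have "real (card (T ` X)) \<le> exp ((C\<^sub>1 + 1) * real n)"
    proof -
      have "real (card (T ` X)) \<le> real (card X)" by (simp add: card_image_le X)
      also have "\<dots> \<le> exp (C\<^sub>1 * real n)" by (rule X)
      also have "\<dots> \<le> exp ((C\<^sub>1 + 1) * real n)" by (simp add: algebra_simps)
      finally show ?thesis .
    qed
    ultimately show "\<exists>Y. finite Y \<and> Y \<subseteq> lp_space 2 \<and> real (card Y) \<le> exp ((C\<^sub>1 + 1) * real n) \<and>
      (\<forall>z. lp_norm p z \<le> 1 \<longrightarrow> (\<exists>y\<in>Y. \<forall>J. L2_set (\<lambda>j. f j * z (N j) - y j) {1..J}
        \<le> (C\<^sub>1 + 1) * \<mu> n * real n powr (- 1 / \<alpha> + 1 / 2 - recip p)))"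
      using X(1) by (intro exI[of _ "T ` X"]) auto
  qed
qed

lemma entropy_number_le_of_net:
  assumes "finite Y" "Y \<noteq> {}" "Y \<subseteq> F" "card Y \<le> 2 ^ (n - 1)" "0 < \<epsilon>"
    and net: "\<And>z. z \<in> E \<Longrightarrow> NE z \<le> 1 \<Longrightarrow> \<exists>y\<in>Y. NF (w z - y) \<le> ereal \<epsilon>"
  shows "entropy_number E NE F NF n w \<le> ereal \<epsilon>"
proof -
  obtain g where g: "bij_betw g {1..card Y} Y"
    using ex_bij_betw_nat_finite_1[OF assms(1)] by blast
  obtain y\<^sub>0 where y\<^sub>0: "y\<^sub>0 \<in> Y" using assms(2) by blast
  define y where "y = (\<lambda>i. if i \<in> {1..card Y} then g i else y\<^sub>0)"
  have "y i \<in> Y" for i using g y\<^sub>0 by (auto simp: y_def bij_betw_def)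
  moreover have "\<exists>i\<in>{1..2 ^ (n - 1)}. NF (w z - y i) \<le> ereal \<epsilon>" if "z \<in> E" "NE z \<le> 1" for z
  proof -
    obtain x where x: "x \<in> Y" "NF (w z - x) \<le> ereal \<epsilon>" using net \<open>z \<in> E\<close> \<open>NE z \<le> 1\<close> by blast
    have "x \<in> g ` {1..card Y}" using g x(1) by (simp add: bij_betw_def)
    then obtain i where i: "i \<in> {1..card Y}" "g i = x" by blast
    then have "y i = x" by (simp add: y_def)
    then show ?thesis using i x assms(4) by (intro bexI[of _ i]) auto
  qed
  ultimately show ?thesis
    unfolding entropy_number_def using assms(3,5) by (intro Inf_lower) blast
qed

text \<open>A net of \<open>exp (C m)\<close> points is admissible for \<open>e\<^sub>n\<close> once \<open>L m \<le> n - 1\<close> with \<open>L \<ge> C / ln 2\<close>. As \<open>m\<close>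
  may be taken proportional to \<open>n\<close>, the growth condition on \<open>\<mu>\<close> turns the bound at \<open>m\<close> into one at \<open>n\<close>.\<close>

lemma entropy_number_weighted_composition_le:
  fixes f \<mu> :: "nat \<Rightarrow> real" and N :: "nat \<Rightarrow> nat"
  assumes \<alpha>: "0 < \<alpha>" "\<alpha> < 2" and p: "1 \<le> p"
    and \<mu>_pos: "\<And>m. 1 \<le> m \<Longrightarrow> 0 < \<mu> m"
    and M: "1 \<le> M" and B: "0 < B"
    and up: "\<And>n m. 1 \<le> n \<Longrightarrow> n \<le> m \<Longrightarrow> \<mu> m \<le> M * \<mu> n"
    and down: "\<And>m n. 1 \<le> m \<Longrightarrow> m \<le> n \<Longrightarrow> \<mu> m \<le> M * (real n / real m) powr B * \<mu> n"
    and K: "0 < K"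
    and N: "\<And>j. 1 \<le> j \<Longrightarrow> 1 \<le> N j"
    and f: "\<And>j. 1 \<le> j \<Longrightarrow> \<bar>f j\<bar> \<le> K * \<mu> (N j) * real j powr (- 1 / \<alpha>)"
    and w: "\<And>z j. 1 \<le> j \<Longrightarrow> w z j = f j * z (N j)"
  shows "\<exists>C>0. \<forall>\<^sub>F n in sequentially.
    entropy_number (lp_space p) (lp_norm p) (lp_space 2) (lp_norm 2) n w
      \<le> ereal (C * (\<mu> n * real n powr (- 1 / \<alpha> + 1 / 2 - recip p)))"
proof -
  define e where "e = - 1 / \<alpha> + 1 / 2 - recip p"
  have "\<exists>C>0. \<forall>n\<ge>1. \<exists>Y. finite Y \<and> Y \<subseteq> lp_space 2 \<and> real (card Y) \<le> exp (C * real n) \<and>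
      (\<forall>z. lp_norm p z \<le> 1 \<longrightarrow> (\<exists>y\<in>Y. \<forall>J. L2_set (\<lambda>j. f j * z (N j) - y j) {1..J} \<le> C * \<mu> n * real n powr e))"
    unfolding e_def by (rule l2_net_of_weighted_composition[OF \<alpha> p _ M B _ _ K]; fact)
  then obtain C where C: "0 < C"
    and net: "\<And>n. 1 \<le> n \<Longrightarrow> \<exists>Y. finite Y \<and> Y \<subseteq> lp_space 2 \<and> real (card Y) \<le> exp (C * real n) \<and>
      (\<forall>z. lp_norm p z \<le> 1 \<longrightarrow> (\<exists>y\<in>Y. \<forall>J. L2_set (\<lambda>j. f j * z (N j) - y j) {1..J} \<le> C * \<mu> n * real n powr e))"
    by blast
  define L where "L = max 1 (nat \<lceil>C / ln 2\<rceil>)"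
  have L: "1 \<le> L" "C / ln 2 \<le> real L" unfolding L_def by linarith+
  then have CL: "C \<le> real L * ln 2" by (simp add: field_simps)
  define C' where "C' = C * (M * (2 * real L) powr B) * (2 * real L) powr \<bar>e\<bar>"
  have C': "0 < C'" using C M L by (simp add: C'_def)
  have "entropy_number (lp_space p) (lp_norm p) (lp_space 2) (lp_norm 2) n w \<le> ereal (C' * (\<mu> n * real n powr e))"
    if n: "L + 1 \<le> n" for n
  proof -
    define m where "m = (n - 1) div L"
    have m: "1 \<le> m" using n L by (simp add: m_def Suc_le_eq div_greater_zero_iff)
    have Lm: "L * m \<le> n - 1" by (simp add: m_def)
    have "n - 1 < L * (m + 1)"
      using L by (simp add: m_def dividend_less_times_div)
    also have "L * (m + 1) \<le> 2 * L * m" using m by simp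
    finally have nLm: "n \<le> 2 * L * m" by linarith
    have "1 * m \<le> L * m" using L by (intro mult_le_mono1)
    then have mn: "m \<le> n" using Lm by linarith
    have n_le: "real n \<le> 2 * real L * real m"
      using nLm by (metis of_nat_le_iff of_nat_mult of_nat_numeral)
    obtain Y where Y: "finite Y" "Y \<subseteq> lp_space 2" "real (card Y) \<le> exp (C * real m)"
      and net_Y: "\<And>z. lp_norm p z \<le> 1 \<Longrightarrow> \<exists>y\<in>Y. \<forall>J. L2_set (\<lambda>j. f j * z (N j) - y j) {1..J} \<le> C * \<mu> m * real m powr e"
      using net[OF m] by blast
    have "lp_norm p (\<lambda>_. 0) \<le> 1" by (rule lp_unit_ball_flat[of p 1]) (use p in auto)
    then have "Y \<noteq> {}" using net_Y by blast
    have "real (card Y) \<le> exp (real (L * m) * ln 2)"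
    proof -
      have "C * real m \<le> (real L * ln 2) * real m" using CL by (intro mult_right_mono) auto
      then show ?thesis using Y(3) by (simp add: mult_ac order_trans)
    qed
    also have "\<dots> = 2 ^ (L * m)" unfolding exp_of_nat_mult by simp
    also have "\<dots> \<le> 2 ^ (n - 1)" using Lm by (intro power_increasing) auto
    finally have "card Y \<le> 2 ^ (n - 1)"
      by (metis of_nat_le_iff of_nat_numeral of_nat_power)
    have \<epsilon>: "0 < C * \<mu> m * real m powr e" using C \<mu>_pos[OF m] m by simp
    have "entropy_number (lp_space p) (lp_norm p) (lp_space 2) (lp_norm 2) n w \<le> ereal (C * \<mu> m * real m powr e)"
    proof (rule entropy_number_le_of_net[OF Y(1) \<open>Y \<noteq> {}\<close> Y(2) \<open>card Y \<le> 2 ^ (n - 1)\<close> \<epsilon>])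
      fix z assume "lp_norm p z \<le> 1"
      from net_Y[OF this] obtain y where y: "y \<in> Y"
        "\<And>J. L2_set (\<lambda>j. f j * z (N j) - y j) {1..J} \<le> C * \<mu> m * real m powr e" by blast
      have "L2_set (w z - y) {1..J} = L2_set (\<lambda>j. f j * z (N j) - y j) {1..J}" for J
        by (rule L2_set_cong) (auto simp: w)
      then have "lp_norm 2 (w z - y) \<le> ereal (C * \<mu> m * real m powr e)"
        unfolding l2_norm_le_iff[OF less_imp_le[OF \<epsilon>]] using y(2) by simp
      then show "\<exists>y\<in>Y. lp_norm 2 (w z - y) \<le> ereal (C * \<mu> m * real m powr e)"
        using y(1) by blast
    qed
    also have "C * \<mu> m * real m powr e \<le> C * (M * (2 * real L) powr B * \<mu> n) * ((2 * real L) powr \<bar>e\<bar> * real n powr e)"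
    proof (intro mult_mono)
      have "\<mu> m \<le> M * (real n / real m) powr B * \<mu> n" by (rule down[OF m mn])
      also have "\<dots> \<le> M * (2 * real L) powr B * \<mu> n"
        using M B \<mu>_pos[of n] n n_le m
        by (intro mult_right_mono mult_left_mono powr_mono2) (auto simp: field_simps)
      finally show "\<mu> m \<le> M * (2 * real L) powr B * \<mu> n" .
      show "real m powr e \<le> (2 * real L) powr \<bar>e\<bar> * real n powr e"
        using m mn n_le by (intro powr_comparable) auto
    qed (use C M \<mu>_pos[of n] \<mu>_pos[OF m] n in auto)
    also have "\<dots> = C' * (\<mu> n * real n powr e)" by (simp add: C'_def)
    finally show ?thesis by simp
  qed
  then show ?thesis
    unfolding e_def[symmetric] using C' by (intro exI[of _ C'] conjI eventually_sequentiallyI[of "L + 1"]) auto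
qed

section \<open>Lower bound for operators with disjointly supported images\<close>

text \<open>With \<open>t \<ge> 1\<close> the weight \<open>t\<^sup>n t\<^sup>-\<^sup>8\<^sup>|\<^sup>D\<^sup>|\<close> is at least one whenever \<open>8 |D| \<le> n\<close>, and its sum over all
  subsets \<open>D\<close> is \<open>(t (1 + t\<^sup>-\<^sup>8)\<^sup>2)\<^sup>n\<close>; for \<open>t = 6/5\<close> the base is below \<open>2\<close>.\<close>

lemma card_hamming_ball_le:
  assumes S: "finite S" "card S = 2 * n" and X\<^sub>0: "X\<^sub>0 \<subseteq> S"
  shows "card {X \<in> Pow S. 8 * card ((X - X\<^sub>0) \<union> (X\<^sub>0 - X)) \<le> n} \<le> 2 ^ n"
proof -
  define t :: real where "t = 6 / 5"
  have t: "1 \<le> t" by (simp add: t_def)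
  let ?\<D> = "{D \<in> Pow S. 8 * card D \<le> n}"
  let ?\<Delta> = "\<lambda>X. (X - X\<^sub>0) \<union> (X\<^sub>0 - X)"
  have fin: "finite ?\<D>" using S by simp
  have "inj ?\<Delta>" by (auto simp: inj_def)
  then have "card {X \<in> Pow S. 8 * card (?\<Delta> X) \<le> n} \<le> card ?\<D>"
    using fin X\<^sub>0 by (intro card_inj_on_le[of ?\<Delta>]) (auto intro: inj_on_subset)
  moreover have "real (card ?\<D>) \<le> 2 ^ n"
  proof -
    have "real (card ?\<D>) = (\<Sum>D\<in>?\<D>. 1)" by simp
    also have "\<dots> \<le> (\<Sum>D\<in>?\<D>. t ^ n * (1 / t ^ 8) ^ card D)"
    proof (rule sum_mono)
      fix D assume "D \<in> ?\<D>"
      then have "t ^ (8 * card D) \<le> t ^ n" by (intro power_increasing) (auto simp: t_def)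
      then show "1 \<le> t ^ n * (1 / t ^ 8) ^ card D"
        using t by (simp add: power_mult[symmetric] power_divide divide_simps)
    qed
    also have "\<dots> \<le> (\<Sum>D\<in>Pow S. t ^ n * (1 / t ^ 8) ^ card D)"
      by (rule sum_mono2) (use S in \<open>auto simp: t_def\<close>)
    also have "\<dots> = t ^ n * (\<Sum>D\<in>Pow S. (\<Prod>_\<in>D. 1 / t ^ 8) * (\<Prod>_\<in>S - D. 1))"
      by (simp add: sum_distrib_left)
    also have "\<dots> = t ^ n * (1 / t ^ 8 + 1) ^ (2 * n)"
      unfolding prod_add[OF S(1), symmetric] using S by simp
    also have "\<dots> = (t * (1 / t ^ 8 + 1)\<^sup>2) ^ n" by (simp add: power_mult power_mult_distrib)
    also have "\<dots> \<le> 2 ^ n" by (intro power_mono) (auto simp: t_def power_divide power2_eq_square)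
    finally show ?thesis .
  qed
  ultimately show ?thesis
    by (metis (no_types, lifting) le_trans of_nat_le_iff of_nat_numeral of_nat_power)
qed

text \<open>Flat vectors that differ on more than \<open>n/8\<close> of the first \<open>2n\<close> coordinates have images at
  distance at least of the order \<open>\<theta>\<^sub>2\<^sub>n n\<^sup>1\<^sup>/\<^sup>\<alpha>\<^sup>-\<^sup>1\<^sup>/\<^sup>p\<close>, since each differing
  coordinate contributes separately to the integral. Two such images in a common \<open>\<epsilon>\<close>-ball are,
  on the other hand, at distance at most of order \<open>\<epsilon>\<close>; for \<open>\<alpha> < 1\<close> this relies on the quasi-triangle inequality for \<open>\<alpha>\<close>-th powers.\<close>

lemma entropy_number_disjoint_support_ge:
  fixes \<theta> :: "nat \<Rightarrow> real" and u :: "(nat \<Rightarrow> real) \<Rightarrow> 's \<Rightarrow> real"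
  assumes \<alpha>: "0 < \<alpha>" and p: "1 \<le> p"
    and \<theta>_pos: "\<And>n. 1 \<le> n \<Longrightarrow> 0 < \<theta> n" and \<theta>_anti: "antimono_on {1..} \<theta>"
    and D: "0 < D" "\<And>n. 1 \<le> n \<Longrightarrow> \<theta> n \<le> D * \<theta> (2 * n)"
    and \<sigma>: "finite_measure \<sigma>"
    and A: "\<And>n. 1 \<le> n \<Longrightarrow> A n \<in> sets \<sigma>" "\<And>n. 1 \<le> n \<Longrightarrow> 0 < measure \<sigma> (A n)" "disjoint_family_on A {1..}"
    and u: "\<And>z m s. 1 \<le> m \<Longrightarrow> s \<in> A m \<Longrightarrow> u z s = \<theta> m * z m / measure \<sigma> (A m) powr (1 / \<alpha>)"
  shows "\<exists>c>0. \<forall>n\<ge>1. ereal (c * (\<theta> n * real n powr (1 / \<alpha> - recip p)))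
      \<le> entropy_number (lp_space p) (lp_norm p) (Lr_space \<alpha> \<sigma>) (Lr_norm \<alpha> \<sigma>) n u"
proof -
  interpret finite_measure \<sigma> by (rule \<sigma>)
  define c where "c = 2 powr - recip p / D * (1 / 8) powr (1 / \<alpha>) / (2 powr (\<alpha> + 1)) powr (1 / \<alpha>)"
  show ?thesis
  proof (intro exI[of _ c] conjI allI impI)
    show "0 < c" using D by (simp add: c_def)
    fix n :: nat assume n: "1 \<le> n"
    define h where "h = real (2 * n) powr - recip p"
    have h: "0 < h" using n by (simp add: h_def)
    define z where "z = (\<lambda>X (m::nat). if m \<in> X then h else 0)"
    have z_ball: "lp_norm p (z X) \<le> 1" if "X \<in> Pow {1..2 * n}" for X
      by (rule lp_unit_ball_flat[of p "2 * n"]) (use p n that h in \<open>auto simp: z_def h_def\<close>)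
    show "ereal (c * (\<theta> n * real n powr (1 / \<alpha> - recip p)))
      \<le> entropy_number (lp_space p) (lp_norm p) (Lr_space \<alpha> \<sigma>) (Lr_norm \<alpha> \<sigma>) n u"
      unfolding entropy_number_def
    proof (rule Inf_greatest)
      fix e assume "e \<in> {ereal \<epsilon> | \<epsilon>. 0 < \<epsilon> \<and>
       (\<exists>y :: nat \<Rightarrow> 's \<Rightarrow> real. (\<forall>i\<in>{1..2 ^ (n - 1)}. y i \<in> Lr_space \<alpha> \<sigma>) \<and>
         (\<forall>z\<in>lp_space p. lp_norm p z \<le> 1 \<longrightarrow> (\<exists>i\<in>{1..2 ^ (n - 1)}. Lr_norm \<alpha> \<sigma> (u z - y i) \<le> ereal \<epsilon>)))}"
      then obtain \<epsilon> and y :: "nat \<Rightarrow> 's \<Rightarrow> real" where e: "e = ereal \<epsilon>" and \<epsilon>: "0 < \<epsilon>"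
        and cover: "\<And>z. z \<in> lp_space p \<Longrightarrow> lp_norm p z \<le> 1 \<Longrightarrow>
          \<exists>i\<in>{1..2 ^ (n - 1)}. Lr_norm \<alpha> \<sigma> (u z - y i) \<le> ereal \<epsilon>"
        by blast
      have "\<exists>i\<in>{1..2 ^ (n - 1)}. Lr_norm \<alpha> \<sigma> (u (z X) - y i) \<le> ereal \<epsilon>" if "X \<in> Pow {1..2 * n}" for X
      proof (rule cover)
        show "lp_norm p (z X) \<le> 1" by (rule z_ball[OF that])
        then show "z X \<in> lp_space p" by (auto simp: lp_space_def intro: le_less_trans)
      qed
      then obtain i where i: "\<And>X. X \<in> Pow {1..2 * n} \<Longrightarrow> i X \<in> {1..2 ^ (n - 1) :: nat}"
        "\<And>X. X \<in> Pow {1..2 * n} \<Longrightarrow> Lr_norm \<alpha> \<sigma> (u (z X) - y (i X)) \<le> ereal \<epsilon>"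
        by metis
      have "\<exists>b\<in>{1..2 ^ (n - 1)}. card (Pow {1..2 * n}) \<le> card (i -` {b} \<inter> Pow {1..2 * n}) * card {1..2 ^ (n - 1) :: nat}"
        by (rule pigeonhole_card) (use i in auto)
      then obtain b where b: "2 ^ (2 * n) \<le> card (i -` {b} \<inter> Pow {1..2 * n}) * 2 ^ (n - 1)"
        by (auto simp: card_Pow)
      define \<F> where "\<F> = i -` {b} \<inter> Pow {1..2 * n}"
      have "(2::nat) ^ (2 * n) = 2 ^ (n + 1) * 2 ^ (n - 1)"
      proof -
        have "2 * n = (n + 1) + (n - 1)" using n by simp
        then show ?thesis by (simp only: power_add)
      qed
      then have card_\<F>: "2 ^ (n + 1) \<le> card \<F>" using b by (simp add: \<F>_def)
      then have "\<F> \<noteq> {}" by auto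
      then obtain X\<^sub>0 where X\<^sub>0: "X\<^sub>0 \<in> \<F>" by blast
      have "card {X \<in> Pow {1..2 * n}. 8 * card ((X - X\<^sub>0) \<union> (X\<^sub>0 - X)) \<le> n} \<le> 2 ^ n"
        by (rule card_hamming_ball_le) (use X\<^sub>0 in \<open>auto simp: \<F>_def\<close>)
      also have "\<dots> < 2 ^ (n + 1)" by simp
      finally have "\<not> \<F> \<subseteq> {X \<in> Pow {1..2 * n}. 8 * card ((X - X\<^sub>0) \<union> (X\<^sub>0 - X)) \<le> n}"
        using card_\<F> card_mono[of "{X \<in> Pow {1..2 * n}. 8 * card ((X - X\<^sub>0) \<union> (X\<^sub>0 - X)) \<le> n}" \<F>]
        by auto
      then obtain X where "X \<in> \<F>" "X \<notin> {X \<in> Pow {1..2 * n}. 8 * card ((X - X\<^sub>0) \<union> (X\<^sub>0 - X)) \<le> n}"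
        by blast
      moreover from this(1) have "X \<in> Pow {1..2 * n}" by (simp add: \<F>_def)
      ultimately have X: "X \<in> \<F>" "n < 8 * card ((X - X\<^sub>0) \<union> (X\<^sub>0 - X))"
        by (simp_all add: not_le)
      define W where "W = (X - X\<^sub>0) \<union> (X\<^sub>0 - X)"
      have W_sub: "W \<subseteq> {1..2 * n}"
        using X X\<^sub>0 unfolding W_def \<F>_def by auto
      then have W: "W \<subseteq> {1..2 * n}" "finite W" "n < 8 * card W"
        using X(2) finite_subset[OF W_sub] by (auto simp: W_def)
      let ?g = "\<lambda>X s. \<bar>u (z X) s - y b s\<bar> powr \<alpha>"
      have g: "integrable \<sigma> (?g X')" "(\<integral>s. ?g X' s \<partial>\<sigma>) \<le> \<epsilon> powr \<alpha>" if "X' \<in> \<F>" for X'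
        using Lr_norm_le_imp[of \<alpha> \<epsilon> \<sigma> "u (z X') - y b"] i(2)[of X'] that \<alpha> \<epsilon> by (auto simp: \<F>_def)
      let ?a = "\<lambda>m. (\<theta> m * h) powr \<alpha>"
      have pointwise: "(\<Sum>m\<in>W. ?a m / measure \<sigma> (A m) * indicator (A m) s) \<le> 2 powr \<alpha> * (?g X s + ?g X\<^sub>0 s)" for s
      proof (cases "\<exists>m\<in>W. s \<in> A m")
        case True
        then obtain m where m: "m \<in> W" "s \<in> A m" by blast
        have m1: "1 \<le> m" using m W by auto
        have "(\<Sum>k\<in>W. ?a k / measure \<sigma> (A k) * indicator (A k) s) = (\<Sum>k\<in>{m}. ?a k / measure \<sigma> (A k) * indicator (A k) s)"
        proof (rule sum.mono_neutral_right)
          show "\<forall>k\<in>W - {m}. ?a k / measure \<sigma> (A k) * indicator (A k) s = 0"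
          proof
            fix k assume k: "k \<in> W - {m}"
            then have "1 \<le> k" using W by auto
            then have "A k \<inter> A m = {}" using disjoint_family_onD[OF A(3), of k m] k m1 by auto
            then show "?a k / measure \<sigma> (A k) * indicator (A k) s = 0" using m by (auto simp: indicator_def)
          qed
        qed (use m W in auto)
        also have "\<dots> = \<bar>\<theta> m * h / measure \<sigma> (A m) powr (1 / \<alpha>)\<bar> powr \<alpha>"
          using m m1 \<theta>_pos[OF m1] h A(2)[OF m1] \<alpha> by (simp add: powr_divide powr_powr)
        also have "\<bar>\<theta> m * h / measure \<sigma> (A m) powr (1 / \<alpha>)\<bar> = \<bar>u (z X) s - u (z X\<^sub>0) s\<bar>"
          using m u[OF m1 m(2)] by (auto simp: z_def W_def)
        also have "\<dots> powr \<alpha> \<le> 2 powr \<alpha> * (?g X s + ?g X\<^sub>0 s)"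
          by (rule abs_diff_powr_le[OF \<alpha>])
        finally show ?thesis .
      next
        case False
        then have "(\<Sum>m\<in>W. ?a m / measure \<sigma> (A m) * indicator (A m) s) = 0"
          by (intro sum.neutral) auto
        then show ?thesis by (simp add: add_nonneg_nonneg)
      qed
      have A_int: "integrable \<sigma> (indicator (A m) :: 's \<Rightarrow> real)" if "m \<in> W" for m
        using A(1)[of m] that W by (auto simp: emeasure_eq_measure)
      have "real n / 8 * (\<theta> n / D * h) powr \<alpha> \<le> (\<Sum>m\<in>W. ?a m)"
      proof -
        have "real n / 8 * (\<theta> n / D * h) powr \<alpha> \<le> real (card W) * (\<theta> n / D * h) powr \<alpha>"
          using W(3) by (intro mult_right_mono) auto
        also have "\<dots> = (\<Sum>m\<in>W. (\<theta> n / D * h) powr \<alpha>)" by simp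
        also have "\<dots> \<le> (\<Sum>m\<in>W. ?a m)"
        proof (rule sum_mono)
          fix m assume m: "m \<in> W"
          have "\<theta> n / D \<le> \<theta> (2 * n)" using D(1) D(2)[OF n] by (simp add: divide_simps mult.commute)
          also have "\<dots> \<le> \<theta> m" using m W n \<theta>_anti by (auto simp: monotone_on_def)
          finally show "(\<theta> n / D * h) powr \<alpha> \<le> ?a m"
            using \<alpha> h D(1) \<theta>_pos[OF n] by (intro powr_mono2 mult_right_mono) auto
        qed
        finally show ?thesis .
      qed
      also have "\<dots> = (\<Sum>m\<in>W. ?a m / measure \<sigma> (A m) * measure \<sigma> (A m))"
        using W A(2) by (intro sum.cong) (auto simp: less_imp_neq[symmetric])
      also have "\<dots> = (\<integral>s. (\<Sum>m\<in>W. ?a m / measure \<sigma> (A m) * indicator (A m) s) \<partial>\<sigma>)"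
      proof (subst Bochner_Integration.integral_sum)
        show "integrable \<sigma> (\<lambda>s. ?a m / measure \<sigma> (A m) * indicator (A m) s)" if "m \<in> W" for m
          using A_int[OF that] by simp
        show "(\<Sum>m\<in>W. ?a m / measure \<sigma> (A m) * measure \<sigma> (A m))
          = (\<Sum>m\<in>W. \<integral>s. ?a m / measure \<sigma> (A m) * indicator (A m) s \<partial>\<sigma>)"
        proof (rule sum.cong[OF refl])
          fix m assume m: "m \<in> W"
          have "1 \<le> m" using m W by auto
          then have "A m \<inter> space \<sigma> = A m" using A(1) sets.sets_into_space by blast
          then show "?a m / measure \<sigma> (A m) * measure \<sigma> (A m) = (\<integral>s. ?a m / measure \<sigma> (A m) * indicator (A m) s \<partial>\<sigma>)"
            by simp
        qed
      qed
      also have "\<dots> \<le> (\<integral>s. 2 powr \<alpha> * (?g X s + ?g X\<^sub>0 s) \<partial>\<sigma>)"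
      proof (rule integral_mono)
        show "integrable \<sigma> (\<lambda>s. \<Sum>m\<in>W. ?a m / measure \<sigma> (A m) * indicator (A m) s)"
          using A_int by (intro Bochner_Integration.integrable_sum integrable_mult_right) auto
        show "integrable \<sigma> (\<lambda>s. 2 powr \<alpha> * (?g X s + ?g X\<^sub>0 s))"
          using g(1)[OF X(1)] g(1)[OF X\<^sub>0] by (intro integrable_mult_right Bochner_Integration.integrable_add)
      qed (rule pointwise)
      also have "\<dots> = 2 powr \<alpha> * ((\<integral>s. ?g X s \<partial>\<sigma>) + (\<integral>s. ?g X\<^sub>0 s \<partial>\<sigma>))"
        using g(1)[OF X(1)] g(1)[OF X\<^sub>0] by simp
      also have "\<dots> \<le> 2 powr \<alpha> * (\<epsilon> powr \<alpha> + \<epsilon> powr \<alpha>)"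
        using g(2)[OF X(1)] g(2)[OF X\<^sub>0] by (intro mult_left_mono add_mono) auto
      also have "\<dots> = 2 powr (\<alpha> + 1) * \<epsilon> powr \<alpha>" by (simp add: powr_add)
      finally have main: "real n / 8 * (\<theta> n / D * h) powr \<alpha> \<le> 2 powr (\<alpha> + 1) * \<epsilon> powr \<alpha>" .
      have "(real n / 8 * (\<theta> n / D * h) powr \<alpha>) powr (1 / \<alpha>) \<le> (2 powr (\<alpha> + 1) * \<epsilon> powr \<alpha>) powr (1 / \<alpha>)"
        using main \<alpha> by (intro powr_mono2) auto
      moreover have "(real n / 8 * (\<theta> n / D * h) powr \<alpha>) powr (1 / \<alpha>) = (real n / 8) powr (1 / \<alpha>) * (\<theta> n / D * h)"
        using \<alpha> D(1) h \<theta>_pos[OF n] by (simp only: powr_mult powr_powr) simp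
      moreover have "(2 powr (\<alpha> + 1) * \<epsilon> powr \<alpha>) powr (1 / \<alpha>) = (2 powr (\<alpha> + 1)) powr (1 / \<alpha>) * \<epsilon>"
        using \<alpha> \<epsilon> by (simp only: powr_mult powr_powr) simp
      ultimately have le: "(real n / 8) powr (1 / \<alpha>) * (\<theta> n / D * h) \<le> (2 powr (\<alpha> + 1)) powr (1 / \<alpha>) * \<epsilon>"
        by (simp only:)
      have "0 < (2 powr (\<alpha> + 1)) powr (1 / \<alpha>)" by simp
      then have "(real n / 8) powr (1 / \<alpha>) * (\<theta> n / D * h) / (2 powr (\<alpha> + 1)) powr (1 / \<alpha>) \<le> \<epsilon>"
        using le by (simp only: pos_divide_le_eq mult.commute[of \<epsilon>])
      moreover have "(real n / 8) powr (1 / \<alpha>) * (\<theta> n / D * h) / (2 powr (\<alpha> + 1)) powr (1 / \<alpha>) 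
          = c * (\<theta> n * real n powr (1 / \<alpha> - recip p))"
      proof -
        have "h = 2 powr - recip p * real n powr - recip p" by (simp add: h_def powr_mult)
        moreover have "(real n / 8) powr (1 / \<alpha>) = real n powr (1 / \<alpha>) * (1 / 8) powr (1 / \<alpha>)"
          by (simp add: powr_divide)
        moreover have "real n powr (1 / \<alpha> - recip p) = real n powr (1 / \<alpha>) * real n powr - recip p"
          using n by (simp add: powr_add[symmetric])
        ultimately show ?thesis by (simp add: c_def)
      qed
      ultimately show "ereal (c * (\<theta> n * real n powr (1 / \<alpha> - recip p))) \<le> e"
        by (simp add: e)
    qed
  qed
qed

section \<open>Linear growth of the arrival times\<close>

lemma nn_integral_exp_minus_exponential:
  assumes "distributed Q lborel X (exponential_density 1)"
  shows "(\<integral>\<^sup>+\<omega>. ennreal (exp (- X \<omega>)) \<partial>Q) = ennreal (1 / 2)"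
proof -
  interpret E: prob_space "density lborel (\<lambda>x. ennreal (exponential_density 2 x))"
    by (rule prob_space_exponential_density) simp
  have "(\<integral>\<^sup>+\<omega>. ennreal (exp (- X \<omega>)) \<partial>Q)
      = (\<integral>\<^sup>+x. ennreal (exponential_density 1 x) * ennreal (exp (- x)) \<partial>lborel)"
    by (rule distributed_nn_integral[OF assms, symmetric]) simp
  also have "\<dots> = (\<integral>\<^sup>+x. ennreal (1 / 2) * ennreal (exponential_density 2 x) \<partial>lborel)"
  proof (rule nn_integral_cong)
    fix x :: real
    have "exponential_density 1 x * exp (- x) = 1 / 2 * exponential_density 2 x"
      by (simp add: exponential_density_def exp_add[symmetric])
    then show "ennreal (exponential_density 1 x) * ennreal (exp (- x)) = ennreal (1 / 2) * ennreal (exponential_density 2 x)"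
      by (subst (1 2) ennreal_mult[symmetric]) (simp_all add: exponential_density_nonneg)
  qed
  also have "\<dots> = ennreal (1 / 2) * (\<integral>\<^sup>+x. ennreal (exponential_density 2 x) \<partial>lborel)"
    by (rule nn_integral_cmult) simp
  also have "(\<integral>\<^sup>+x. ennreal (exponential_density 2 x) \<partial>lborel) = 1"
    using E.emeasure_space_1 by (simp add: emeasure_density)
  finally show ?thesis by simp
qed

context random_series
begin

lemma arrival_measurable: "arrival \<zeta> j \<in> borel_measurable Q"
  unfolding arrival_def using distributed_measurable[OF \<zeta>_law] by (intro borel_measurable_sum) auto

lemma nn_integral_exp_minus_arrival:
  "(\<integral>\<^sup>+\<omega>. ennreal (exp (- arrival \<zeta> j \<omega>)) \<partial>Q) = ennreal ((1 / 2) ^ j)"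
proof -
  have "indep_vars (\<lambda>_. borel) (\<lambda>i. (\<lambda>x. ennreal (exp (- x))) \<circ> \<zeta> i) {1..j}"
    by (rule indep_vars_compose[OF indep_vars_subset[OF \<zeta>_indep]]) auto
  then have indep: "indep_vars (\<lambda>_. borel) (\<lambda>i \<omega>. ennreal (exp (- \<zeta> i \<omega>))) {1..j}"
    by (simp add: comp_def)
  have "(\<integral>\<^sup>+\<omega>. ennreal (exp (- arrival \<zeta> j \<omega>)) \<partial>Q) = (\<integral>\<^sup>+\<omega>. (\<Prod>i\<in>{1..j}. ennreal (exp (- \<zeta> i \<omega>))) \<partial>Q)"
    by (simp add: arrival_def prod_ennreal exp_sum sum_negf[symmetric])
  also have "\<dots> = (\<Prod>i\<in>{1..j}. \<integral>\<^sup>+\<omega>. ennreal (exp (- \<zeta> i \<omega>)) \<partial>Q)"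
    by (rule indep_vars_nn_integral[OF _ indep]) auto
  also have "\<dots> = (\<Prod>i\<in>{1..j}. ennreal (1 / 2))"
    by (intro prod.cong refl) (simp only: nn_integral_exp_minus_exponential[OF \<zeta>_law] atLeastAtMost_iff)
  also have "\<dots> = ennreal (\<Prod>i\<in>{1..j}. 1 / 2)" by (rule prod_ennreal) simp
  also have "(\<Prod>i\<in>{1..j}. 1 / 2 :: real) = (1 / 2) ^ j" by simp
  finally show ?thesis .
qed

text \<open>An exponential Markov bound suffices instead of a law of large numbers: \<open>\<Gamma>\<^sub>j \<le> j/2\<close> has probability
  at most \<open>(exp (1/2) / 2)\<^sup>j\<close>, which is summable.\<close>

lemma AE_eventually_arrival_ge: "AE \<omega> in Q. \<forall>\<^sub>F j in sequentially. real j / 2 \<le> arrival \<zeta> j \<omega>"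
proof -
  let ?A = "\<lambda>j. {\<omega> \<in> space Q. arrival \<zeta> j \<omega> \<le> real j / 2}"
  let ?q = "exp (1 / 2) / 2 :: real"
  have A: "?A j \<in> sets Q" for j
    using arrival_measurable[of j] by measurable
  have "(exp (1 / 2 :: real))\<^sup>2 < 2\<^sup>2"
    using exp_le by (simp add: exp_double[symmetric])
  then have "exp (1 / 2 :: real) < 2" by (rule power2_less_imp_less) simp
  then have q: "?q < 1" by simp
  have le: "measure Q (?A j) \<le> ?q ^ j" for j
  proof -
    have "emeasure Q (?A j) \<le> emeasure Q {\<omega> \<in> space Q. 1 \<le> ennreal (exp (real j / 2)) * ennreal (exp (- arrival \<zeta> j \<omega>))}"
    proof (rule emeasure_mono)
      show "?A j \<subseteq> {\<omega> \<in> space Q. 1 \<le> ennreal (exp (real j / 2)) * ennreal (exp (- arrival \<zeta> j \<omega>))}"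
        by (auto simp: ennreal_mult[symmetric] exp_add[symmetric] ennreal_1[symmetric] ennreal_le_iff simp del: ennreal_1)
      show "{\<omega> \<in> space Q. 1 \<le> ennreal (exp (real j / 2)) * ennreal (exp (- arrival \<zeta> j \<omega>))} \<in> sets Q"
        using arrival_measurable[of j] by measurable
    qed
    also have "\<dots> \<le> ennreal (exp (real j / 2)) * (\<integral>\<^sup>+\<omega>. ennreal (exp (- arrival \<zeta> j \<omega>)) * indicator (space Q) \<omega> \<partial>Q)"
      by (rule nn_integral_Markov_inequality) (use arrival_measurable[of j] in measurable)
    also have "(\<integral>\<^sup>+\<omega>. ennreal (exp (- arrival \<zeta> j \<omega>)) * indicator (space Q) \<omega> \<partial>Q) = (\<integral>\<^sup>+\<omega>. ennreal (exp (- arrival \<zeta> j \<omega>)) \<partial>Q)"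
      by (intro nn_integral_cong) auto
    also have "ennreal (exp (real j / 2)) * \<dots> = ennreal (?q ^ j)"
      unfolding nn_integral_exp_minus_arrival
      by (simp add: ennreal_mult[symmetric] power_divide exp_of_nat_mult[symmetric])
    finally show ?thesis by (simp add: emeasure_eq_measure)
  qed
  have "AE \<omega> in Q. \<forall>\<^sub>F j in sequentially. \<omega> \<in> space Q - ?A j"
  proof (rule borel_cantelli_AE1[OF A])
    show "emeasure Q (?A j) < \<infinity>" for j by (simp add: emeasure_eq_measure)
    show "summable (\<lambda>j. measure Q (?A j))"
      by (rule summable_comparison_test'[of "\<lambda>j. ?q ^ j" 0]) (use q le in \<open>auto intro!: summable_geometric\<close>)
  qed
  then show ?thesis
  proof eventually_elim
    case (elim \<omega>)
    then show ?case by eventually_elim auto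
  qed
qed

text \<open>The finitely many \<open>j\<close> before linear growth sets in are absorbed into the constant, because the
  arrival times are almost surely positive.\<close>

lemma AE_arrival_linear_growth: "AE \<omega> in Q. \<exists>c>0. \<forall>j\<ge>1. c * real j \<le> arrival \<zeta> j \<omega>"
proof -
  have "AE \<omega> in Q. 0 < \<zeta> j \<omega>" if "1 \<le> j" for j
  proof -
    have "AE x in lborel. x \<noteq> (0::real)" by (rule AE_lborel_singleton)
    then have "AE x in lborel. exponential_density 1 x \<noteq> 0 \<longrightarrow> (0::real) < x"
      by eventually_elim (auto simp: exponential_density_def)
    then have "AE x in density lborel (\<lambda>x. ennreal (exponential_density 1 x)). (0::real) < x"
      by (subst AE_density) (auto elim!: eventually_mono)
    then have "AE x in distr Q lborel (\<zeta> j). 0 < x"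
      unfolding distributed_distr_eq_density[OF \<zeta>_law[OF that]] .
    then show ?thesis
      using distributed_measurable[OF \<zeta>_law[OF that]] by (subst (asm) AE_distr_iff) auto
  qed
  then have "AE \<omega> in Q. \<forall>j\<in>{1..}. 0 < \<zeta> j \<omega>"
    by (subst AE_ball_countable) auto
  with AE_eventually_arrival_ge show ?thesis
  proof eventually_elim
    case (elim \<omega>)
    have pos: "0 < arrival \<zeta> j \<omega>" if "1 \<le> j" for j
      unfolding arrival_def using elim(2) that by (intro sum_pos) auto
    obtain J where J: "\<And>j. J \<le> j \<Longrightarrow> real j / 2 \<le> arrival \<zeta> j \<omega>"
      using elim(1) unfolding eventually_sequentially by blast
    define c where "c = Min (insert (1 / 2) ((\<lambda>j. arrival \<zeta> j \<omega> / real j) ` {1..J}))"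
    have "0 < c" unfolding c_def using pos by (subst Min_gr_iff) auto
    moreover have "c * real j \<le> arrival \<zeta> j \<omega>" if j: "1 \<le> j" for j
    proof (cases "j \<le> J")
      case True
      then have "c \<le> arrival \<zeta> j \<omega> / real j" unfolding c_def using j by (intro Min_le) auto
      then show ?thesis using j by (simp add: field_simps)
    next
      case False
      have "c \<le> 1 / 2" unfolding c_def by (intro Min_le) auto
      then have "c * real j \<le> 1 / 2 * real j" by (rule mult_right_mono) simp
      moreover have "real j / 2 \<le> arrival \<zeta> j \<omega>" using False by (intro J) simp
      ultimately show ?thesis by linarith
    qed
    ultimately show ?case by blast
  qed
qed

end

section \<open>Measurability of entropy numbers\<close>

text \<open>The countable dense family for points of the \<open>\<ell>\<^sub>p\<close>-ball as well as for centres in \<open>\<ell>\<^sub>2\<close>.\<close>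

definition rat_seq :: "rat list \<Rightarrow> nat \<Rightarrow> real" where
  "rat_seq l j = (if j < length l then of_rat (l ! j) else 0)"

lemma rat_seq_mem_l2: "rat_seq l \<in> lp_space 2"
  by (rule finite_support_mem_l2[of "length l"]) (simp add: rat_seq_def)

text \<open>Density holds only in the pointwise sense, as it must for \<open>p = \<infinity>\<close>. Rounding towards zero keeps the
  approximations in the unit ball.\<close>

lemma lp_unit_ball_pointwise_dense:
  assumes p: "1 \<le> p" and z: "lp_norm p z \<le> 1"
  obtains x where "\<And>k. x k \<in> range rat_seq" "\<And>k. lp_norm p (x k) \<le> 1" "\<And>m. (\<lambda>k. x k m) \<longlonglongrightarrow> z m"
proof -
  have "\<exists>i :: int. real_of_int \<bar>i\<bar> * (1 / real (Suc k)) \<le> \<bar>z m\<bar> \<and>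
      \<bar>z m - real_of_int i * (1 / real (Suc k))\<bar> \<le> 1 / real (Suc k)" for k m
    using truncate_to_grid[of "1 / real (Suc k)" "z m"] by (metis of_nat_0_less_iff zero_less_Suc zero_less_divide_1_iff)
  then obtain i :: "nat \<Rightarrow> nat \<Rightarrow> int" where i:
    "\<And>k m. real_of_int \<bar>i k m\<bar> * (1 / real (Suc k)) \<le> \<bar>z m\<bar>"
    "\<And>k m. \<bar>z m - real_of_int (i k m) * (1 / real (Suc k))\<bar> \<le> 1 / real (Suc k)"
    by metis
  define x where "x = (\<lambda>k. rat_seq (map (\<lambda>m. of_int (i k m) / of_nat (Suc k)) [0..<k]))"
  have x: "x k m = (if m < k then real_of_int (i k m) * (1 / real (Suc k)) else 0)" for k m
    by (simp add: x_def rat_seq_def of_rat_divide del: of_nat_Suc)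
  show thesis
  proof (rule that)
    show "x k \<in> range rat_seq" for k by (simp add: x_def)
    show "lp_norm p (x k) \<le> 1" for k
    proof (rule lp_unit_ball_mono[OF p z])
      fix m show "\<bar>x k m\<bar> \<le> \<bar>z m\<bar>" using i(1)[of k m] by (simp add: x abs_mult)
    qed
    show "(\<lambda>k. x k m) \<longlonglongrightarrow> z m" for m
    proof -
      have "(\<lambda>k. x k m - z m) \<longlonglongrightarrow> 0"
      proof (rule Lim_null_comparison)
        show "\<forall>\<^sub>F k in sequentially. norm (x k m - z m) \<le> 1 / real (Suc k)"
          using eventually_gt_at_top[of m]
        proof eventually_elim
          case (elim k)
          then show ?case using i(2)[where k = k and m = m] by (simp add: x abs_minus_commute)
        qed
        show "(\<lambda>k. 1 / real (Suc k)) \<longlonglongrightarrow> 0" by (rule LIMSEQ_Suc[OF lim_1_over_n])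
      qed
      then show ?thesis by (rule LIM_zero_cancel)
    qed
  qed
qed

lemma l2_dense:
  assumes y: "y \<in> lp_space 2" and \<delta>: "0 < \<delta>"
  shows "\<exists>x\<in>range rat_seq. \<forall>J. L2_set (\<lambda>j. y j - x j) {1..J} \<le> \<delta>"
proof -
  obtain t where t: "\<And>J. L2_set y {1..J} \<le> t" using y mem_l2_iff by blast
  define s where "s = (\<lambda>J. \<Sum>j=1..J. (y j)\<^sup>2)"
  have s_le: "s J \<le> t\<^sup>2" for J
    using t[of J] by (auto simp: s_def L2_set_def dest: sqrt_le_D)
  then have bdd: "bdd_above (range s)" by (intro bdd_aboveI[of _ "t\<^sup>2"]) auto
  have "(SUP J. s J) - \<delta>\<^sup>2 / 2 < (SUP J. s J)" using \<delta> by simp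
  then obtain K where K: "(SUP J. s J) - \<delta>\<^sup>2 / 2 < s K"
    using less_cSUP_iff[of UNIV s] bdd by auto
  have tail: "(\<Sum>j=Suc K..J. (y j)\<^sup>2) \<le> \<delta>\<^sup>2 / 2" for J
  proof (cases "K \<le> J")
    case True
    then have "{1..J} = {1..K} \<union> {Suc K..J}" by auto
    then have "s J = s K + (\<Sum>j=Suc K..J. (y j)\<^sup>2)"
      unfolding s_def by (simp add: sum.union_disjoint)
    moreover have "s J \<le> (SUP J. s J)" using bdd by (intro cSUP_upper) auto
    ultimately show ?thesis using K by linarith
  qed auto
  define \<eta> where "\<eta> = \<delta> / sqrt (2 * real (Suc K))"
  have \<eta>: "0 < \<eta>" using \<delta> by (simp add: \<eta>_def)
  have "\<exists>r. y j < real_of_rat r \<and> real_of_rat r < y j + \<eta>" for j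
    using of_rat_dense[of "y j" "y j + \<eta>"] \<eta> by auto
  then obtain r where r: "\<And>j. y j < real_of_rat (r j)" "\<And>j. real_of_rat (r j) < y j + \<eta>" by metis
  define x where "x = rat_seq (map r [0..<Suc K])"
  have x: "x j = (if j \<le> K then real_of_rat (r j) else 0)" for j
    by (simp add: x_def rat_seq_def less_Suc_eq_le nth_append del: upt_Suc)
  have "L2_set (\<lambda>j. y j - x j) {1..J} \<le> \<delta>" for J
  proof -
    have "(\<Sum>j=1..J. (y j - x j)\<^sup>2) \<le> (\<Sum>j\<in>{1..K} \<union> {Suc K..J}. (y j - x j)\<^sup>2)"
      by (rule sum_mono2) auto
    also have "\<dots> = (\<Sum>j=1..K. (y j - x j)\<^sup>2) + (\<Sum>j=Suc K..J. (y j - x j)\<^sup>2)"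
      by (rule sum.union_disjoint) auto
    also have "(\<Sum>j=Suc K..J. (y j - x j)\<^sup>2) = (\<Sum>j=Suc K..J. (y j)\<^sup>2)"
      by (rule sum.cong) (auto simp: x)
    also have "(\<Sum>j=1..K. (y j - x j)\<^sup>2) \<le> (\<Sum>j=1..K. \<eta>\<^sup>2)"
    proof (rule sum_mono)
      fix j assume "j \<in> {1..K}"
      then have "\<bar>y j - x j\<bar> \<le> \<eta>" using r[of j] by (simp add: x)
      then have "\<bar>y j - x j\<bar>\<^sup>2 \<le> \<eta>\<^sup>2" by (intro power_mono) auto
      then show "(y j - x j)\<^sup>2 \<le> \<eta>\<^sup>2" by simp
    qed
    also have "\<dots> = real K * \<eta>\<^sup>2" by simp
    also have "\<dots> \<le> real (Suc K) * \<eta>\<^sup>2" by (intro mult_right_mono) auto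
    also have "\<dots> = \<delta>\<^sup>2 / 2" by (simp add: \<eta>_def power_divide field_simps)
    finally have "(\<Sum>j=1..J. (y j - x j)\<^sup>2) \<le> \<delta>\<^sup>2" using tail[of J] by linarith
    then show ?thesis unfolding L2_set_def using \<delta> by (intro real_le_lsqrt) (auto intro: sum_nonneg)
  qed
  then show ?thesis unfolding x_def by blast
qed

text \<open>Continuity of every coordinate with respect to pointwise convergence; no boundedness into
  \<open>\<ell>\<^sub>2\<close> is included, since it may fail for exceptional paths.\<close>

definition pointwise_continuous :: "((nat \<Rightarrow> real) \<Rightarrow> nat \<Rightarrow> real) \<Rightarrow> bool" where
  "pointwise_continuous w \<longleftrightarrow> (\<forall>x z j. 1 \<le> j \<longrightarrow> (\<forall>m. (\<lambda>k. x k m) \<longlonglongrightarrow> z m) \<longrightarrow> (\<lambda>k. w (x k) j) \<longlonglongrightarrow> w z j)"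

text \<open>Centres and radius may be perturbed, so rational ones suffice. Conversely, a cover of the rational
  points of the ball covers all of it: along a sequence converging pointwise to \<open>z\<close> one centre is used
  infinitely often, and the bound on each finite section passes to the limit.\<close>

lemma entropy_number_less_iff:
  fixes w :: "(nat \<Rightarrow> real) \<Rightarrow> nat \<Rightarrow> real"
  assumes p: "1 \<le> p"
    and cont: "pointwise_continuous w"
  shows "entropy_number (lp_space p) (lp_norm p) (lp_space 2) (lp_norm 2) n w < t \<longleftrightarrow>
    (\<exists>r\<in>{r. 0 < r \<and> ereal (real_of_rat r) < t}. \<exists>y\<in>{1..2 ^ (n - 1) :: nat} \<rightarrow>\<^sub>E range rat_seq.
      \<forall>z\<in>{z \<in> range rat_seq. lp_norm p z \<le> 1}. \<exists>i\<in>{1..2 ^ (n - 1)}.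
        \<forall>J. L2_set (\<lambda>j. w z j - y i j) {1..J} \<le> real_of_rat r)"
    (is "?e < t \<longleftrightarrow> ?R")
proof
  let ?I = "{1..2 ^ (n - 1)} :: nat set"
  assume "?e < t"
  then obtain \<epsilon> y\<^sub>0 where \<epsilon>: "0 < \<epsilon>" "ereal \<epsilon> < t" and y\<^sub>0: "\<And>i. i \<in> ?I \<Longrightarrow> y\<^sub>0 i \<in> lp_space 2"
    and cover: "\<And>z. z \<in> lp_space p \<Longrightarrow> lp_norm p z \<le> 1 \<Longrightarrow> \<exists>i\<in>?I. lp_norm 2 (w z - y\<^sub>0 i) \<le> ereal \<epsilon>"
    unfolding entropy_number_def Inf_less_iff by blast
  \<comment> \<open>The gap between \<open>\<epsilon>\<close> and a rational \<open>r\<close> below \<open>t\<close> leaves room for moving the centres.\<close>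
  obtain t' where t': "ereal \<epsilon> < ereal t'" "ereal t' < t" using ereal_dense2[OF \<epsilon>(2)] by blast
  obtain r where r: "\<epsilon> < real_of_rat r" "real_of_rat r < t'" using of_rat_dense[of \<epsilon> t'] t' by auto
  have r_t: "ereal (real_of_rat r) < t" using r(2) t'(2) by (metis ereal_less_eq(3) le_less_trans less_imp_le)
  have "0 < real_of_rat r" using \<epsilon> r by linarith
  then have r0: "0 < r" by simp
  have "\<exists>x\<in>range rat_seq. \<forall>J. L2_set (\<lambda>j. y\<^sub>0 i j - x j) {1..J} \<le> real_of_rat r - \<epsilon>" if "i \<in> ?I" for i
    using l2_dense[OF y\<^sub>0[OF that]] r(1) by simp
  then obtain y' where y': "\<And>i. i \<in> ?I \<Longrightarrow> y' i \<in> range rat_seq"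
    "\<And>i J. i \<in> ?I \<Longrightarrow> L2_set (\<lambda>j. y\<^sub>0 i j - y' i j) {1..J} \<le> real_of_rat r - \<epsilon>" by metis
  define y where "y = restrict y' ?I"
  have "\<exists>i\<in>?I. \<forall>J. L2_set (\<lambda>j. w z j - y i j) {1..J} \<le> real_of_rat r" if z: "lp_norm p z \<le> 1" for z
  proof -
    have "z \<in> lp_space p" using z by (auto simp: lp_space_def intro: le_less_trans)
    then obtain i where i: "i \<in> ?I" "lp_norm 2 (w z - y\<^sub>0 i) \<le> ereal \<epsilon>" using cover z by blast
    have "L2_set (\<lambda>j. w z j - y i j) {1..J} \<le> real_of_rat r" for J
    proof -
      have "L2_set (\<lambda>j. w z j - y i j) {1..J} = L2_set (\<lambda>j. (w z - y\<^sub>0 i) j + (y\<^sub>0 i j - y i j)) {1..J}"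
        by simp
      also have "\<dots> \<le> L2_set (w z - y\<^sub>0 i) {1..J} + L2_set (\<lambda>j. y\<^sub>0 i j - y i j) {1..J}"
        by (rule L2_set_triangle_ineq)
      also have "\<dots> \<le> \<epsilon> + (real_of_rat r - \<epsilon>)"
        using i y'(2)[OF i(1)] l2_norm_le_iff[OF less_imp_le[OF \<epsilon>(1)]] by (intro add_mono) (auto simp: y_def)
      finally show ?thesis by simp
    qed
    then show ?thesis using i(1) by blast
  qed
  moreover have "y \<in> ?I \<rightarrow>\<^sub>E range rat_seq" using y'(1) by (auto simp: y_def)
  ultimately show ?R using r0 r_t by blast
next
  let ?I = "{1..2 ^ (n - 1)} :: nat set"
  assume ?R
  then obtain r y where r: "0 < r" "ereal (real_of_rat r) < t" and y: "y \<in> ?I \<rightarrow>\<^sub>E range rat_seq"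
    and cover: "\<And>z. z \<in> range rat_seq \<Longrightarrow> lp_norm p z \<le> 1 \<Longrightarrow>
      \<exists>i\<in>?I. \<forall>J. L2_set (\<lambda>j. w z j - y i j) {1..J} \<le> real_of_rat r"
    by blast
  have r0: "0 < real_of_rat r" using r by simp
  have y_l2: "y i \<in> lp_space 2" if "i \<in> ?I" for i
    using y that rat_seq_mem_l2 by (auto simp: PiE_def Pi_def)
  have "\<exists>i\<in>?I. lp_norm 2 (w z - y i) \<le> ereal (real_of_rat r)" if z: "lp_norm p z \<le> 1" for z
  proof -
    obtain x where x: "\<And>k. x k \<in> range rat_seq" "\<And>k. lp_norm p (x k) \<le> 1" "\<And>m. (\<lambda>k. x k m) \<longlonglongrightarrow> z m"
      using lp_unit_ball_pointwise_dense[OF p z] by blast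
    have "\<forall>k\<in>UNIV. \<exists>i\<in>?I. \<forall>J. L2_set (\<lambda>j. w (x k) j - y i j) {1..J} \<le> real_of_rat r"
      using cover x by blast
    then have "\<exists>i\<in>?I. infinite {k \<in> UNIV. \<forall>J. L2_set (\<lambda>j. w (x k) j - y i j) {1..J} \<le> real_of_rat r}"
      by (intro pigeonhole_infinite_rel) auto
    then obtain i where i: "i \<in> ?I"
      and inf: "infinite {k. \<forall>J. L2_set (\<lambda>j. w (x k) j - y i j) {1..J} \<le> real_of_rat r}" by auto
    have "L2_set (w z - y i) {1..J} \<le> real_of_rat r" for J
    proof (rule ccontr)
      assume "\<not> L2_set (w z - y i) {1..J} \<le> real_of_rat r"
      then have less: "real_of_rat r < L2_set (\<lambda>j. w z j - y i j) {1..J}"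
        by (simp add: fun_diff_def)
      have "(\<lambda>k. w (x k) j) \<longlonglongrightarrow> w z j" if "1 \<le> j" for j
        using cont x(3) that unfolding pointwise_continuous_def by blast
      then have "(\<lambda>k. L2_set (\<lambda>j. w (x k) j - y i j) {1..J}) \<longlonglongrightarrow> L2_set (\<lambda>j. w z j - y i j) {1..J}"
        unfolding L2_set_def by (intro tendsto_intros) auto
      then have "\<forall>\<^sub>F k in sequentially. real_of_rat r < L2_set (\<lambda>j. w (x k) j - y i j) {1..J}"
        using less by (rule order_tendstoD(1))
      then have "finite {k. \<not> real_of_rat r < L2_set (\<lambda>j. w (x k) j - y i j) {1..J}}"
        unfolding cofinite_eq_sequentially[symmetric] eventually_cofinite .
      then have "finite {k. \<forall>J. L2_set (\<lambda>j. w (x k) j - y i j) {1..J} \<le> real_of_rat r}"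
        by (rule rev_finite_subset) (auto simp: not_less)
      then show False using inf by blast
    qed
    then show ?thesis using i l2_norm_le_iff[OF less_imp_le[OF r0]] by blast
  qed
  then have "?e \<le> ereal (real_of_rat r)"
    unfolding entropy_number_def using r0 y_l2 by (intro Inf_lower) blast
  then show "?e < t" using r(2) by (rule le_less_trans)
qed

lemma entropy_number_measurable:
  fixes w :: "'d \<Rightarrow> (nat \<Rightarrow> real) \<Rightarrow> nat \<Rightarrow> real"
  assumes p: "1 \<le> p"
    and meas: "\<And>z j. 1 \<le> j \<Longrightarrow> (\<lambda>\<omega>. w \<omega> z j) \<in> borel_measurable Q"
    and cont: "\<And>\<omega>. pointwise_continuous (w \<omega>)"
  shows "(\<lambda>\<omega>. entropy_number (lp_space p) (lp_norm p) (lp_space 2) (lp_norm 2) n (w \<omega>)) \<in> borel_measurable Q"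
proof (rule borel_measurableI_less)
  fix t
  have L2: "(\<lambda>\<omega>. L2_set (\<lambda>j. w \<omega> z j - y j) {1..J}) \<in> borel_measurable Q" for z y J
  proof -
    have "(\<lambda>\<omega>. \<Sum>j=1..J. (w \<omega> z j - y j)\<^sup>2) \<in> borel_measurable Q"
      using meas by (intro borel_measurable_sum borel_measurable_power borel_measurable_diff) auto
    then show ?thesis unfolding L2_set_def by measurable
  qed
  have ev: "{\<omega> \<in> space Q. L2_set (\<lambda>j. w \<omega> z j - y j) {1..J} \<le> r} \<in> sets Q" for z y J and r :: real
    using L2[of z y J] by measurable
  show "{\<omega> \<in> space Q. entropy_number (lp_space p) (lp_norm p) (lp_space 2) (lp_norm 2) n (w \<omega>) < t} \<in> sets Q"
    unfolding entropy_number_less_iff[OF p cont]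
    by (intro sets.sets_Collect_countable_Ex' sets.sets_Collect_countable_All'
        sets.sets_Collect_countable_All ev countable_PiE countable_Collect) auto
qed

section \<open>The entropy gap\<close>

theorem proposition6p1:
  fixes \<alpha> c a b :: real and p :: ereal
    and d \<theta> :: "nat \<Rightarrow> real"
    and A :: "nat \<Rightarrow> real set"
    and Q :: "'d measure"
    and V \<zeta> :: "nat \<Rightarrow> 'd \<Rightarrow> real"
    and u :: "(nat \<Rightarrow> real) \<Rightarrow> real \<Rightarrow> real"
  assumes \<alpha>: "0 < \<alpha>" "\<alpha> < 2"
    and p: "1 \<le> p"
    and d_pos: "\<And>n. n \<ge> 1 \<Longrightarrow> 0 < d n"
    and d_monotone: "mono_on {1..} d \<or> antimono_on {1..} d"
    and \<theta>_pos: "\<And>n. n \<ge> 1 \<Longrightarrow> 0 < \<theta> n"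
    and \<theta>_decreasing: "antimono_on {1..} \<theta>"
    and \<theta>_null: "\<theta> \<longlonglongrightarrow> 0"
    and d_doubling: "same_order d (\<lambda>n. d (2 * n))"
    and \<theta>_doubling: "same_order \<theta> (\<lambda>n. \<theta> (2 * n))"
    and d_summable: "summable (\<lambda>n. d n powr (- \<alpha>) / real n)"
    and c: "0 < c"
    and A_measurable: "\<And>n. n \<ge> 1 \<Longrightarrow> A n \<in> sets lebesgue"
    and A_subset: "\<And>n. n \<ge> 1 \<Longrightarrow> A n \<subseteq> {0..1}"
    and A_disjoint: "disjoint_family_on A {1..}"
    and A_measure: "\<And>n. n \<ge> 1 \<Longrightarrow> measure lebesgue (A n) = c * d n powr (- \<alpha>) / real n"
    and a: "ereal a > max (1 / ereal \<alpha> - 1 / p) 0"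
    and a_growth: "(SUP (k, n) \<in> {(k, n). 1 \<le> k \<and> k \<le> n}.
        ereal ((real n / real k) powr a * (\<theta> n / \<theta> k))) < \<infinity>"
    and b: "0 < b"
    and b_growth: "(SUP (k, n) \<in> {(k, n). 1 \<le> k \<and> k \<le> n}.
        ereal ((real n / real k) powr b *
          ((\<theta> n * measure lebesgue (A n) powr (- 1 / \<alpha>))
           / (\<theta> k * measure lebesgue (A k) powr (- 1 / \<alpha>))))) < \<infinity>"
    and u: "u = (\<lambda>z s. \<Sum>\<^sub>\<infinity>n\<in>{1..}.
        \<theta> n * z n * (indicator (A n) s / measure lebesgue (A n) powr (1 / \<alpha>)))"
    and Q: "random_series Q (lebesgue_on {0..1}) V \<zeta>"
  shows "\<P>(\<omega> in Q. limsup (\<lambda>n.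
           entropy_gap (lp_space p) (lp_norm p) \<alpha> (lebesgue_on {0..1}) V \<zeta> u n \<omega> / ereal (d n))
           < \<infinity>) = 1"
proof -
  let ?\<sigma> = "lebesgue_on {0..1::real}"
  interpret Q: random_series Q ?\<sigma> V \<zeta> by (rule Q)
  define q where "q = recip p"

  have A_sets: "A n \<in> sets ?\<sigma>" if "1 \<le> n" for n
    using A_measurable[OF that] A_subset[OF that] by (simp add: sets_restrict_space_iff)
  have A_meas: "measure ?\<sigma> (A n) = measure lebesgue (A n)" if "1 \<le> n" for n
    using A_subset[OF that] by (intro measure_restrict_space) auto
  have A_pos: "0 < measure lebesgue (A n)" if "1 \<le> n" for n
    using A_measure[OF that] c d_pos[OF that] that by simp
  have A_unique: "m = k" if "1 \<le> m" "1 \<le> k" "s \<in> A m" "s \<in> A k" for m k s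
    using disjoint_family_onD[OF A_disjoint, of m k] that by auto

  define \<mu> where "\<mu> = (\<lambda>m. \<theta> m * measure lebesgue (A m) powr (- 1 / \<alpha>))"
  have \<mu>_pos: "0 < \<mu> m" if "1 \<le> m" for m
    using \<theta>_pos[OF that] A_pos[OF that] by (simp add: \<mu>_def)
  have \<mu>_eq: "\<mu> m = c powr (- 1 / \<alpha>) * (\<theta> m * d m * real m powr (1 / \<alpha>))" if "1 \<le> m" for m
  proof -
    have "measure lebesgue (A m) powr (- 1 / \<alpha>)
        = c powr (- 1 / \<alpha>) * (d m powr (- \<alpha>)) powr (- 1 / \<alpha>) / real m powr (- 1 / \<alpha>)"
      using A_measure[OF that] by (simp add: powr_divide powr_mult)
    also have "(d m powr (- \<alpha>)) powr (- 1 / \<alpha>) = d m"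
      using d_pos[OF that] \<alpha> by (simp add: powr_powr)
    finally have A_powr: "measure lebesgue (A m) powr (- 1 / \<alpha>) = c powr (- 1 / \<alpha>) * d m / real m powr (- 1 / \<alpha>)" .
    show ?thesis unfolding \<mu>_def A_powr by (simp add: powr_minus_divide)
  qed

  obtain M\<^sub>1 B\<^sub>1 where M\<^sub>1: "1 \<le> M\<^sub>1" "0 < B\<^sub>1"
    and \<theta>_growth: "\<And>m n. 1 \<le> m \<Longrightarrow> m \<le> n \<Longrightarrow> \<theta> m \<le> M\<^sub>1 * (real n / real m) powr B\<^sub>1 * \<theta> n"
    using doubling_growth[OF \<theta>_pos _ \<theta>_doubling] \<theta>_decreasing by blast
  obtain M\<^sub>2 B\<^sub>2 where M\<^sub>2: "1 \<le> M\<^sub>2" "0 < B\<^sub>2"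
    and d_growth: "\<And>m n. 1 \<le> m \<Longrightarrow> m \<le> n \<Longrightarrow> d m \<le> M\<^sub>2 * (real n / real m) powr B\<^sub>2 * d n"
    using doubling_growth[OF d_pos d_monotone d_doubling] by blast
  obtain M\<^sub>3 where \<mu>_b: "\<And>k n. 1 \<le> k \<Longrightarrow> k \<le> n \<Longrightarrow> (real n / real k) powr b * (\<mu> n / \<mu> k) \<le> M\<^sub>3"
  proof -
    let ?S = "SUP (k, n) \<in> {(k, n). 1 \<le> k \<and> k \<le> n}. ereal ((real n / real k) powr b * (\<mu> n / \<mu> k))"
    have "?S < \<infinity>" using b_growth by (simp add: \<mu>_def)
    then obtain M\<^sub>3 where M\<^sub>3: "?S \<le> ereal M\<^sub>3" by (cases ?S) auto
    have "(real n / real k) powr b * (\<mu> n / \<mu> k) \<le> M\<^sub>3" if "1 \<le> k" "k \<le> n" for k n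
    proof -
      have "ereal ((real n / real k) powr b * (\<mu> n / \<mu> k)) \<le> ?S"
        using that by (intro SUP_upper2[of "(k, n)"]) auto
      from order_trans[OF this M\<^sub>3] show ?thesis by (simp only: ereal_less_eq)
    qed
    then show ?thesis using that by blast
  qed
  define M where "M = max (M\<^sub>1 * M\<^sub>2) M\<^sub>3"
  define B where "B = B\<^sub>1 + B\<^sub>2"
  have M: "1 \<le> M" using M\<^sub>1(1) M\<^sub>2(1) mult_mono[of 1 M\<^sub>1 1 M\<^sub>2] by (simp add: M_def le_max_iff_disj)
  have B: "0 < B" using M\<^sub>1 M\<^sub>2 by (simp add: B_def)
  have up: "\<mu> m \<le> M * \<mu> n" if "1 \<le> n" "n \<le> m" for n m
  proof -
    have "1 \<le> (real m / real n) powr b" using that b by (intro ge_one_powr_ge_zero) auto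
    then have "1 * (\<mu> m / \<mu> n) \<le> (real m / real n) powr b * (\<mu> m / \<mu> n)"
      using \<mu>_pos[of m] \<mu>_pos[of n] that by (intro mult_right_mono) auto
    also have "\<dots> \<le> M" using \<mu>_b[OF that] by (simp add: M_def)
    finally show ?thesis using \<mu>_pos[of n] that by (simp add: pos_divide_le_eq)
  qed
  have down: "\<mu> m \<le> M * (real n / real m) powr B * \<mu> n" if "1 \<le> m" "m \<le> n" for m n
  proof -
    let ?r = "real n / real m"
    have n: "1 \<le> n" using that by simp
    have "\<theta> m * d m * real m powr (1 / \<alpha>)
        \<le> (M\<^sub>1 * ?r powr B\<^sub>1 * \<theta> n) * (M\<^sub>2 * ?r powr B\<^sub>2 * d n) * real n powr (1 / \<alpha>)"
    proof (intro mult_mono \<theta>_growth d_growth that)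
      show "real m powr (1 / \<alpha>) \<le> real n powr (1 / \<alpha>)" using that \<alpha> by (intro powr_mono2) auto
    qed (use M\<^sub>1 M\<^sub>2 \<theta>_pos[OF n] \<theta>_pos[OF that(1)] d_pos[OF n] d_pos[OF that(1)] in auto)
    also have "\<dots> = (M\<^sub>1 * M\<^sub>2) * ?r powr B * (\<theta> n * d n * real n powr (1 / \<alpha>))"
      by (simp add: B_def powr_add mult_ac)
    also have "\<dots> \<le> M * ?r powr B * (\<theta> n * d n * real n powr (1 / \<alpha>))"
      using \<theta>_pos[OF n] d_pos[OF n] by (intro mult_right_mono) (auto simp: M_def)
    finally have "c powr (- 1 / \<alpha>) * (\<theta> m * d m * real m powr (1 / \<alpha>))
      \<le> c powr (- 1 / \<alpha>) * (M * ?r powr B * (\<theta> n * d n * real n powr (1 / \<alpha>)))"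
      by (rule mult_left_mono) simp
    then show ?thesis unfolding \<mu>_eq[OF that(1)] \<mu>_eq[OF n] by (simp only: mult_ac)
  qed

  have u_on: "u z s = \<theta> m * z m / measure lebesgue (A m) powr (1 / \<alpha>)" if "1 \<le> m" "s \<in> A m" for z m s
  proof -
    have "u z s = (\<Sum>\<^sub>\<infinity>n\<in>{m}. \<theta> n * z n * (indicator (A n) s / measure lebesgue (A n) powr (1 / \<alpha>)))"
      unfolding u by (rule infsum_cong_neutral) (use that A_unique in \<open>auto simp: indicator_def\<close>)
    then show ?thesis using that by simp
  qed
  have u_off: "u z s = 0" if "\<And>m. 1 \<le> m \<Longrightarrow> s \<notin> A m" for z s
    unfolding u using that by (intro infsum_0) auto
  have u_measurable: "u z \<in> borel_measurable ?\<sigma>" for z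
  proof -
    let ?g = "\<lambda>m s. if 1 \<le> m then \<theta> m * z m * (indicator (A m) s / measure lebesgue (A m) powr (1 / \<alpha>)) else 0"
    have "?g m \<in> borel_measurable ?\<sigma>" for m
    proof (cases "1 \<le> m")
      case True
      then have "(indicator (A m) :: real \<Rightarrow> real) \<in> borel_measurable ?\<sigma>"
        using A_sets by (intro borel_measurable_indicator)
      then show ?thesis using True by (auto intro!: borel_measurable_times borel_measurable_divide)
    qed simp
    then have "(\<lambda>s. \<Sum>m. ?g m s) \<in> borel_measurable ?\<sigma>" by (rule borel_measurable_suminf)
    moreover have "(\<Sum>m. ?g m s) = u z s" for s
    proof (cases "\<exists>m\<ge>1. s \<in> A m")
      case True
      then obtain m where m: "1 \<le> m" "s \<in> A m" by blast
      have "(\<Sum>k. ?g k s) = (\<Sum>k\<in>{m}. ?g k s)"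
        by (rule suminf_finite) (use m A_unique in \<open>auto simp: indicator_def\<close>)
      then show ?thesis using m u_on by simp
    next
      case False
      then have "?g m s = 0" for m by auto
      then show ?thesis using u_off[of s z] False by auto
    qed
    ultimately show ?thesis by simp
  qed

  define \<kappa> where "\<kappa> = c_const \<alpha> * measure ?\<sigma> (space ?\<sigma>) powr (1 / \<alpha>)"
  \<comment> \<open>A path \<open>\<omega>\<close> turns \<open>v\<close> into \<open>z \<mapsto> (f\<^sub>j z\<^bsub>N(j)\<^esub>)\<^sub>j\<close>. If \<open>V\<^sub>j\<close> misses all sets \<open>A\<^sub>m\<close>, the value \<open>N(j) = 1\<close> is
    arbitrary, as then \<open>f\<^sub>j = 0\<close>.\<close>
  define hit where "hit = (\<lambda>\<omega> j m. 1 \<le> m \<and> V j \<omega> \<in> A m)"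
  define N where "N = (\<lambda>\<omega> j. if Ex (hit \<omega> j) then SOME m. hit \<omega> j m else 1)"
  define f where "f = (\<lambda>\<omega> j. if Ex (hit \<omega> j) then \<kappa> * (\<mu> (N \<omega> j) * arrival \<zeta> j \<omega> powr (- 1 / \<alpha>)) else 0)"
  let ?v = "random_operator \<alpha> ?\<sigma> V \<zeta> u"
  have N_hit: "hit \<omega> j (N \<omega> j)" if "Ex (hit \<omega> j)" for \<omega> j
    using someI_ex[OF that] that by (simp add: N_def)
  have N_ge: "1 \<le> N \<omega> j" for \<omega> j
    using N_hit[of \<omega> j] by (cases "Ex (hit \<omega> j)") (auto simp: N_def hit_def)
  have v_eq: "?v \<omega> z j = f \<omega> j * z (N \<omega> j)" for \<omega> z j
  proof (cases "Ex (hit \<omega> j)")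
    case True
    then have "u z (V j \<omega>) = \<mu> (N \<omega> j) * z (N \<omega> j)"
      using N_hit[OF True] u_on by (simp add: hit_def \<mu>_def powr_minus_divide)
    then show ?thesis using True by (simp add: random_operator_def f_def \<kappa>_def)
  next
    case False
    then have "u z (V j \<omega>) = 0" by (intro u_off) (auto simp: hit_def)
    moreover have "f \<omega> j = 0" using False unfolding f_def by (simp only: if_False)
    ultimately show ?thesis by (simp add: random_operator_def)
  qed

  have v_cont: "pointwise_continuous (?v \<omega>)" for \<omega>
    unfolding pointwise_continuous_def v_eq by (auto intro: tendsto_mult_left)
  have v_measurable: "(\<lambda>\<omega>. ?v \<omega> z j) \<in> borel_measurable Q" if "1 \<le> j" for z j
  proof -
    have "(\<lambda>\<omega>. u z (V j \<omega>)) \<in> borel_measurable Q"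
      by (rule measurable_compose[OF Q.V_measurable[OF that] u_measurable])
    then show ?thesis
      unfolding random_operator_def using Q.arrival_measurable[of j] by measurable
  qed
  let ?e\<^sub>v = "\<lambda>n \<omega>. entropy_number (lp_space p) (lp_norm p) (lp_space 2) (lp_norm 2) n (?v \<omega>)"
  let ?e\<^sub>u = "\<lambda>n. entropy_number (lp_space p) (lp_norm p) (Lr_space \<alpha> ?\<sigma>) (Lr_norm \<alpha> ?\<sigma>) n u"
  let ?gap = "\<lambda>n \<omega>. entropy_gap (lp_space p) (lp_norm p) \<alpha> ?\<sigma> V \<zeta> u n \<omega>"
  have e_v_measurable: "?e\<^sub>v n \<in> borel_measurable Q" for n
    by (rule entropy_number_measurable[OF p v_measurable v_cont])
  have gap_measurable: "(\<lambda>\<omega>. limsup (\<lambda>n. ?gap n \<omega> / ereal (d n))) \<in> borel_measurable Q"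
    unfolding entropy_gap_def
    by (intro borel_measurable_limsup borel_measurable_ereal_divide e_v_measurable) auto
  have event: "{\<omega> \<in> space Q. limsup (\<lambda>n. ?gap n \<omega> / ereal (d n)) < \<infinity>} \<in> sets Q"
    using gap_measurable by measurable

  have "\<exists>c\<^sub>0>0. \<forall>n\<ge>1. ereal (c\<^sub>0 * (\<theta> n * real n powr (1 / \<alpha> - q))) \<le> ?e\<^sub>u n"
    unfolding q_def
  proof (rule entropy_number_disjoint_support_ge[OF \<alpha>(1) p])
    show "0 < M\<^sub>1 * 2 powr B\<^sub>1" using M\<^sub>1 by simp
    show "\<theta> n \<le> M\<^sub>1 * 2 powr B\<^sub>1 * \<theta> (2 * n)" if "1 \<le> n" for n
      using \<theta>_growth[of n "2 * n"] that by simp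
    show "finite_measure ?\<sigma>" by (rule finite_measure_lebesgue_on) auto
    show "0 < measure ?\<sigma> (A n)" if "1 \<le> n" for n using A_pos[OF that] A_meas[OF that] by simp
    show "u z s = \<theta> m * z m / measure ?\<sigma> (A m) powr (1 / \<alpha>)" if "1 \<le> m" "s \<in> A m" for z m s
      unfolding A_meas[OF that(1)] by (rule u_on[OF that])
  qed (fact \<theta>_pos \<theta>_decreasing A_sets A_disjoint)+
  then obtain c\<^sub>0 where c\<^sub>0: "0 < c\<^sub>0"
    "\<And>n. 1 \<le> n \<Longrightarrow> ereal (c\<^sub>0 * (\<theta> n * real n powr (1 / \<alpha> - q))) \<le> ?e\<^sub>u n"
    by blast

  have "AE \<omega> in Q. limsup (\<lambda>n. ?gap n \<omega> / ereal (d n)) < \<infinity>"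
    using Q.AE_arrival_linear_growth
  proof eventually_elim
    case (elim \<omega>)
    then obtain c' where c': "0 < c'" "\<And>j. 1 \<le> j \<Longrightarrow> c' * real j \<le> arrival \<zeta> j \<omega>" by blast
    \<comment> \<open>Adding \<open>1\<close> keeps \<open>K\<close> positive even if \<open>\<kappa>\<close> should vanish.\<close>
    define K where "K = \<bar>\<kappa>\<bar> * c' powr (- 1 / \<alpha>) + 1"
    have K: "0 < K" by (simp add: K_def add_nonneg_pos)
    have f_le: "\<bar>f \<omega> j\<bar> \<le> K * \<mu> (N \<omega> j) * real j powr (- 1 / \<alpha>)" if j: "1 \<le> j" for j
    proof -
      have "arrival \<zeta> j \<omega> powr (- 1 / \<alpha>) \<le> (c' * real j) powr (- 1 / \<alpha>)"
        using c'(2)[OF j] c'(1) j \<alpha> by (intro powr_mono2') auto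
      also have "\<dots> = c' powr (- 1 / \<alpha>) * real j powr (- 1 / \<alpha>)" by (simp add: powr_mult)
      finally have *: "arrival \<zeta> j \<omega> powr (- 1 / \<alpha>) \<le> c' powr (- 1 / \<alpha>) * real j powr (- 1 / \<alpha>)" .
      have \<mu>0: "0 < \<mu> (N \<omega> j)" by (rule \<mu>_pos[OF N_ge])
      have "\<bar>f \<omega> j\<bar> \<le> \<bar>\<kappa>\<bar> * (\<mu> (N \<omega> j) * arrival \<zeta> j \<omega> powr (- 1 / \<alpha>))"
        using \<mu>0 by (simp add: f_def abs_mult)
      also have "\<dots> \<le> \<bar>\<kappa>\<bar> * (\<mu> (N \<omega> j) * (c' powr (- 1 / \<alpha>) * real j powr (- 1 / \<alpha>)))"
        using * \<mu>0 by (intro mult_left_mono) auto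
      also have "\<dots> = (K - 1) * (\<mu> (N \<omega> j) * real j powr (- 1 / \<alpha>))" by (simp add: K_def mult_ac)
      also have "\<dots> \<le> K * (\<mu> (N \<omega> j) * real j powr (- 1 / \<alpha>))" using \<mu>0 by (intro mult_right_mono) auto
      finally show ?thesis by (simp only: mult.assoc)
    qed
    have "\<exists>C>0. \<forall>\<^sub>F n in sequentially. ?e\<^sub>v n \<omega> \<le> ereal (C * (\<mu> n * real n powr (- 1 / \<alpha> + 1 / 2 - recip p)))"
    proof (rule entropy_number_weighted_composition_le
        [where f = "f \<omega>" and N = "N \<omega>" and \<mu> = \<mu>, OF \<alpha> p _ M B _ _ K])
      show "1 \<le> N \<omega> j" for j by (rule N_ge)
      show "\<bar>f \<omega> j\<bar> \<le> K * \<mu> (N \<omega> j) * real j powr (- 1 / \<alpha>)" if "1 \<le> j" for j by (rule f_le[OF that])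
      show "?v \<omega> z j = f \<omega> j * z (N \<omega> j)" for z j by (rule v_eq)
    qed (fact \<mu>_pos up down)+
    then obtain C where C: "0 < C"
      "\<forall>\<^sub>F n in sequentially. ?e\<^sub>v n \<omega> \<le> ereal (C * (\<mu> n * real n powr (- 1 / \<alpha> + 1 / 2 - q)))"
      unfolding q_def by blast
    have "\<forall>\<^sub>F n in sequentially. ?gap n \<omega> / ereal (d n) \<le> ereal (C * c powr (- 1 / \<alpha>) / c\<^sub>0)"
      using C(2) eventually_ge_at_top[of 1]
    proof eventually_elim
      case (elim n)
      have n: "1 \<le> n" by fact
      define X where "X = C * (\<mu> n * real n powr (- 1 / \<alpha> + 1 / 2 - q))"
      define Y where "Y = c\<^sub>0 * (\<theta> n * real n powr (1 / \<alpha> - q))"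
      define k where "k = real n powr (- 1 / \<alpha> + 1 / 2)"
      have "?gap n \<omega> / ereal (d n) \<le> ereal (X / (k * Y) / d n)"
        unfolding entropy_gap_def k_def[symmetric]
      proof (rule ereal_ratio_le)
        show "?e\<^sub>v n \<omega> \<le> ereal X" unfolding X_def by (rule elim)
        show "ereal Y \<le> ?e\<^sub>u n" unfolding Y_def by (rule c\<^sub>0(2)[OF n])
        show "0 < Y" "0 < k" "0 < d n" "0 \<le> X"
          using c\<^sub>0 C(1) n \<theta>_pos[OF n] d_pos[OF n] \<mu>_pos[OF n] by (auto simp: X_def Y_def k_def)
      qed
      also have "X / (k * Y) / d n = C * c powr (- 1 / \<alpha>) / c\<^sub>0"
      proof -
        have "X = C * c powr (- 1 / \<alpha>) * (\<theta> n * d n) * (real n powr (1 / \<alpha>) * real n powr (- 1 / \<alpha> + 1 / 2 - q))"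
          by (simp add: X_def \<mu>_eq[OF n])
        also have "real n powr (1 / \<alpha>) * real n powr (- 1 / \<alpha> + 1 / 2 - q) = real n powr (1 / 2 - q)"
          by (simp add: powr_add[symmetric])
        finally have X: "X = C * c powr (- 1 / \<alpha>) * (\<theta> n * d n) * real n powr (1 / 2 - q)" .
        have "k * Y = c\<^sub>0 * \<theta> n * (real n powr (- 1 / \<alpha> + 1 / 2) * real n powr (1 / \<alpha> - q))"
          by (simp add: k_def Y_def)
        also have "real n powr (- 1 / \<alpha> + 1 / 2) * real n powr (1 / \<alpha> - q) = real n powr (1 / 2 - q)"
          by (simp add: powr_add[symmetric])
        finally have kY: "k * Y = c\<^sub>0 * \<theta> n * real n powr (1 / 2 - q)" .
        show ?thesis unfolding X kY using c\<^sub>0 n \<theta>_pos[OF n] d_pos[OF n] by simp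
      qed
      finally show ?case .
    qed
    then have "limsup (\<lambda>n. ?gap n \<omega> / ereal (d n)) \<le> ereal (C * c powr (- 1 / \<alpha>) / c\<^sub>0)"
      by (rule Limsup_bounded)
    then show ?case by (rule le_less_trans) simp
  qed
  then show ?thesis
    using Q.prob_Collect_eq_1[OF event] by simp
qed

end
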